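(* Let $U\subseteq V$ be finite-dimensional $\mathbb{F}_q$-subspaces of $S$ and let $\mu\subseteq\lambda$ be partitions. (1) If the number of indices $i$ with $\lambda_i>\mu_i$ is strictly less than $\dim U$, then $$S_{\lambda/\mu}(V)=\sum_{L\subseteq U,\ \dim L=1}S_{\lambda/\mu}(V/L).$$ (2) If the number of indices $j$ with $\lambda'_j>\mu'_j$ is strictly less than $\dim U$, then $$T_{\lambda/\mu}(V)=\sum_{L\subseteq U,\ \dim L=1}T_{\lambda/\mu}(V/L).$$ Here the sums run over all one-dimensional $\mathbb{F}_q$-subspaces $L$ of $U$.
   Context: Let $q$ be a power of a prime $p$, $S=\mathbb{F}_q[x_1,\dots,x_n]$, $\widehat S=\bigcup_{r\ge0}\mathbb{F}_q[x_1^{q^{-r}},\dots,x_n^{q^{-r}}]$, $\varphi(u)=u^q$ the Frobenius automorphism of $\widehat S$. For a subspace $W\subset S$ of dimension $k$ with basis $w_1,\dots,w_k$ and strictly decreasing nonnegative integers $\alpha_1>\dots>\alpha_k$, $A_\alpha(W)=\det(w_i^{q^{\alpha_j}})_{i,j}$; for a partition $\lambda$ with at most $k$ nonzero parts, $S_\lambda(W)=A_{\lambda+\delta_k}(W)/A_{\delta_k}(W)$, $\delta_k=(k-1,\dots,0)$ (basis independent). $E_r(W)=S_{(1^r)}(W)$ for $0\le r\le k$ and $0$ otherwise; $H_r(W)=S_{(r)}(W)$ for $r\ge0$, $H_r(W)=0$ for $r<0$ (for $k=0$: $E_0=H_0=1$, others $0$). For partitions $\lambda,\mu$, $N=\max\{\ell(\lambda),\ell(\mu)\}$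 ($\ell$ = number of nonzero parts): $S_{\lambda/\mu}(W)=\det\big(\varphi^{\mu_j-j+1}H_{\lambda_i-\mu_j-i+j}(W)\big)_{1\le i,j\le N}$ and $T_{\lambda/\mu}(W)=\det\big((-1)^{\lambda_i-\mu_j-i+j}\varphi^{\lambda_i-i}E_{\lambda_i-\mu_j-i+j}(W)\big)_{1\le i,j\le N}$. $\lambda'$ denotes the conjugate partition. Quotients: for subspaces $L\subseteq V$ of $S$, $f_L(X)=\prod_{u\in L}(X+u)$ is an $\mathbb{F}_q$-linear map $S\to S$ with kernel $L$, and $V/L:=f_L(V)$, a subspace of $S$ of dimension $\dim V-\dim L$. $\mu\subseteq\lambda$ means $\mu_i\le\lambda_i$ for all $i$. *)

theory Defs
  imports "HOL-Library.Poly_Mapping" "Jordan_Normal_Form.Determinant"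
begin

(* Ambient ring.  Elements are finite formal 'k-linear combinations of monomials
  x^m with m :: nat \<Rightarrow>\<^sub>0 rat (variable i has rational exponent m i).  This ring
  contains S = F_q[x_0..x_(n-1)] and the perfect closure S-hat; the finite field F_q
  is the type 'k (q = card (UNIV :: 'k set)). *)

type_synonym 'k hpoly = "(nat \<Rightarrow>\<^sub>0 rat) \<Rightarrow>\<^sub>0 'k"

definition smul :: "'k::{field,finite} \<Rightarrow> 'k hpoly \<Rightarrow> 'k hpoly" where
  "smul c u = Poly_Mapping.single 0 c * u"

definition polyS :: "nat \<Rightarrow> ('k::{field,finite}) hpoly set" where
  "polyS n = {u. \<forall>m \<in> Poly_Mapping.keys u. \<forall>i \<in> Poly_Mapping.keys m. i < n \<and> Poly_Mapping.lookup m i \<in> \<nat>}"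

definition frob :: "int \<Rightarrow> ('k::{field,finite}) hpoly \<Rightarrow> 'k hpoly" where
  "frob k u = (if 0 \<le> k then u ^ (card (UNIV :: 'k set) ^ nat k)
               else (THE v. v ^ (card (UNIV :: 'k set) ^ nat (- k)) = u))"

abbreviation fsubspace :: "('k::{field,finite}) hpoly set \<Rightarrow> bool" where
  "fsubspace W \<equiv> module.subspace smul W"

abbreviation fdim :: "('k::{field,finite}) hpoly set \<Rightarrow> nat" where
  "fdim W \<equiv> vector_space.dim smul W"

definition fin_dim :: "('k::{field,finite}) hpoly set \<Rightarrow> bool" where
  "fin_dim W \<longleftrightarrow> (\<exists>B. finite B \<and> module.span smul B = W)"

definition fbasis :: "('k::{field,finite}) hpoly set \<Rightarrow> 'k hpoly list" where
  "fbasis W = (SOME ws. distinct ws \<and> module.independent smul (set ws)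
                        \<and> module.span smul (set ws) = W)"

definition moore :: "('k::{field,finite}) hpoly list \<Rightarrow> nat list \<Rightarrow> 'k hpoly" where
  "moore ws \<alpha> = det (mat (length ws) (length ws)
        (\<lambda>(i,j). (ws ! i) ^ (card (UNIV :: 'k set) ^ (\<alpha> ! j))))"

(* S_lambda(W) for lambda given as a list of length k = dim W (padded with zeros):
  A_(lambda+delta)(W) / A_delta(W). *)
definition schurW :: "('k::{field,finite}) hpoly set \<Rightarrow> nat list \<Rightarrow> 'k hpoly" where
  "schurW W lam = (let ws = fbasis W; k = length ws in
     THE s. s * moore ws (map (\<lambda>j. k - 1 - j) [0..<k])
              = moore ws (map (\<lambda>j. lam ! j + (k - 1 - j)) [0..<k]))"

definition Hq :: "('k::{field,finite}) hpoly set \<Rightarrow> int \<Rightarrow> 'k hpoly" where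
  "Hq W r = (if r < 0 then 0
             else if fdim W = 0 then (if r = 0 then 1 else 0)
             else schurW W (nat r # replicate (fdim W - 1) 0))"

definition Eq :: "('k::{field,finite}) hpoly set \<Rightarrow> int \<Rightarrow> 'k hpoly" where
  "Eq W r = (if 0 \<le> r \<and> r \<le> int (fdim W)
             then schurW W (replicate (nat r) 1 @ replicate (fdim W - nat r) 0)
             else 0)"

definition is_partition :: "nat list \<Rightarrow> bool" where
  "is_partition l \<longleftrightarrow> sorted_wrt (\<ge>) l \<and> 0 \<notin> set l"

definition part :: "nat list \<Rightarrow> nat \<Rightarrow> nat" where
  "part l i = (if 1 \<le> i \<and> i \<le> length l then l ! (i - 1) else 0)"

definition conj_part :: "nat list \<Rightarrow> nat \<Rightarrow> nat" where
  "conj_part l j = (if 1 \<le> j then length (filter (\<lambda>x. j \<le> x) l) else 0)"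

definition skewS :: "nat list \<Rightarrow> nat list \<Rightarrow> ('k::{field,finite}) hpoly set \<Rightarrow> 'k hpoly" where
  "skewS lam mu W = (let N = max (length lam) (length mu) in
     det (mat N N (\<lambda>(i,j).
        frob (int (part mu (j+1)) - int (j+1) + 1)
          (Hq W (int (part lam (i+1)) - int (part mu (j+1)) - int (i+1) + int (j+1))))))"

definition skewT :: "nat list \<Rightarrow> nat list \<Rightarrow> ('k::{field,finite}) hpoly set \<Rightarrow> 'k hpoly" where
  "skewT lam mu W = (let N = max (length lam) (length mu) in
     det (mat N N (\<lambda>(i,j).
        let e = int (part lam (i+1)) - int (part mu (j+1)) - int (i+1) + int (j+1) in
        (if even e then 1 else -1) *
        frob (int (part lam (i+1)) - int (i+1)) (Eq W e))))"

(* Quotient V/L = f_L(V), f_L(X) = prod over u in L (X + u). *)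
definition quotW :: "('k::{field,finite}) hpoly set \<Rightarrow> 'k hpoly set \<Rightarrow> 'k hpoly set" where
  "quotW V L = (\<lambda>v. \<Prod>u\<in>L. (v + u)) ` V"

end

theory Submission
  imports Defs "HOL-Library.Cardinality"
begin

text \<open>
  Write \<open>e\<^sub>r = (-1)\<^sup>r E\<^sub>r\<close>, \<open>d = dim V\<close>, and let \<open>L\<close> be spanned by \<open>u\<close>. Then \<open>f_L(X) = X^q - u^(q-1) X\<close>, and
  the factorisation of \<open>f_V\<close> through \<open>f_L\<close> gives
  \<open>H\<^sub>r(V/L) = H\<^sub>r(V) - \<phi>^(d+r-2)(u^(q-1)) H\<^sub>r\<^sub>-\<^sub>1(V)\<close> and
  \<open>e\<^sub>r(V) = e\<^sub>r(V/L) - e\<^sub>r\<^sub>-\<^sub>1(V/L) \<phi>^(d-r)(u^(q-1))\<close>.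
  In the determinant for \<open>S(V/L)\<close> the twist of \<open>u^(q-1)\<close> depends only on the row, so row expansion writes it
  as a sum of products of twists of \<open>u^(q-1)\<close> with coefficients that depend on \<open>V\<close> only. A term that modifies
  a row with \<open>\<lambda>\<^sub>i = \<mu>\<^sub>i\<close> vanishes, so fewer than \<open>dim U\<close> twists occur. For \<open>T\<close> the same works with columns,
  after the recursion has been iterated. By the argument of Chevalley and Warning, a product of fewer than
  \<open>dim U\<close> twists of \<open>u^(q-1)\<close> sums to zero over \<open>U\<close>. As each line has \<open>q - 1 = -1\<close> generators, the sum over
  lines equals the value of the expansion at \<open>u = 0\<close>, which is the determinant for \<open>V\<close>.
\<close>

subsection \<open>Finite fields and the Frobenius automorphism\<close>

lemma card_field_ge_2: "2 \<le> CARD('k::{field,finite})"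
proof -
  have "card {0::'k, 1} \<le> CARD('k)" by (intro card_mono) auto
  thus ?thesis by simp
qed

lemma finite_field_power_card_minus_1:
  fixes c :: "'k::{field,finite}"
  assumes "c \<noteq> 0"
  shows "c ^ (CARD('k) - 1) = 1"
proof -
  let ?A = "UNIV - {0::'k}"
  have "bij_betw ((*) c) ?A ?A"
    by (rule bij_betwI[where g = "\<lambda>x. x / c"]) (use assms in auto)
  hence "(\<Prod>x\<in>?A. c * x) = (\<Prod>x\<in>?A. x)"
    by (rule prod.reindex_bij_betw)
  hence "c ^ card ?A * (\<Prod>x\<in>?A. x) = 1 * (\<Prod>x\<in>?A. x)"
    by (simp add: prod.distrib)
  moreover have "(\<Prod>x\<in>?A. x) \<noteq> 0" by simp
  ultimately have "c ^ card ?A = 1" by (metis mult_right_cancel)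
  thus ?thesis by (simp add: card_Diff_singleton)
qed

lemma finite_field_power_card [simp]:
  fixes c :: "'k::{field,finite}"
  shows "c ^ CARD('k) = c"
proof (cases "c = 0")
  case False
  have "c ^ Suc (CARD('k) - 1) = c"
    unfolding power_Suc using finite_field_power_card_minus_1[OF False] by simp
  moreover have "Suc (CARD('k) - 1) = CARD('k)" using card_field_ge_2[where 'k='k] by simp
  ultimately show ?thesis by simp
qed (use card_field_ge_2[where 'k='k] in \<open>auto simp: zero_power\<close>)

lemma finite_field_power_card_power [simp]:
  fixes c :: "'k::{field,finite}"
  shows "c ^ (CARD('k) ^ n) = c"
  by (induction n) (simp_all add: power_mult)

text \<open>Translation by 1 permutes the field, so the sum of all elements equals itself plus q
  ones.\<close>

lemma of_nat_card_field [simp]: "of_nat CARD('k) = (0::'k::{field,finite})"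
proof -
  have "bij_betw (\<lambda>x::'k. x + 1) UNIV UNIV"
    by (rule bij_betwI[where g = "\<lambda>x. x - 1"]) auto
  hence "(\<Sum>x\<in>UNIV. x + 1) = (\<Sum>x\<in>UNIV. x::'k)" by (rule sum.reindex_bij_betw)
  thus ?thesis by (simp add: sum.distrib)
qed

text \<open>As X^s - 1 has at most s roots, for 0 < s < q - 1 some nonzero \<open>c0\<close> has
  \<open>c0 ^ s\<close> different from 1, and scaling by \<open>c0\<close> multiplies the sum by
  \<open>c0 ^ s\<close> without changing it. For s = 0 the sum is q, as
  \<open>0 ^ 0 = 1\<close>.\<close>

lemma finite_field_sum_power:
  assumes "s < CARD('k::{field,finite}) - 1"
  shows "(\<Sum>c\<in>UNIV. c ^ s) = (0::'k)"
proof (cases "s = 0")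
  case False
  let ?p = "Polynomial.monom (1::'k) s - 1"
  have "\<exists>c0. c0 \<noteq> 0 \<and> c0 ^ s \<noteq> (1::'k)"
  proof (rule ccontr)
    assume "\<not> ?thesis"
    hence "UNIV - {0} \<subseteq> {x. poly ?p x = 0}" by (auto simp: poly_monom)
    hence "card (UNIV - {0::'k}) \<le> card {x. poly ?p x = 0}" by (intro card_mono) auto
    also have "?p \<noteq> 0"
    proof
      assume "?p = 0"
      hence "poly.coeff ?p s = 0" by simp
      with False show False by simp
    qed
    hence "card {x. poly ?p x = 0} \<le> degree ?p" by (rule card_poly_roots_bound)
    also have "\<dots> \<le> s"
      by (rule degree_diff_le) (auto simp: degree_monom_le)
    finally show False using assms by (simp add: card_Diff_singleton)
  qed
  then obtain c0 :: 'k where c0: "c0 \<noteq> 0" "c0 ^ s \<noteq> 1" by blast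
  have "bij_betw ((*) c0) UNIV UNIV"
    by (rule bij_betwI[where g = "\<lambda>x. x / c0"]) (use c0 in auto)
  hence "(\<Sum>x\<in>UNIV. (c0 * x) ^ s) = (\<Sum>x\<in>UNIV. x ^ s)"
    by (rule sum.reindex_bij_betw)
  hence "(c0 ^ s - 1) * (\<Sum>x\<in>UNIV. x ^ s) = 0"
    by (simp add: power_mult_distrib sum_distrib_left[symmetric] left_diff_distrib)
  with c0 show ?thesis by simp
qed simp

text \<open>(1 + X)^q - X^q - 1 has degree below q and vanishes at all q field elements, so it is
  zero. This way the characteristic never has to be named.\<close>

lemma of_nat_binomial_card_field:
  assumes "0 < i" "i < CARD('k::{field,finite})"
  shows "of_nat (CARD('k) choose i) = (0::'k)"
proof -
  let ?q = "CARD('k)"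
  let ?p = "[:1, 1::'k:] ^ ?q - (Polynomial.monom 1 ?q + 1)"
  have coeff: "poly.coeff ([:1, 1::'k:] ^ ?q) j = of_nat (?q choose j)" if "j \<le> ?q" for j
    using coeff_linear_poly_power[of j ?q 1 1] that by simp
  have "degree ?p < ?q"
  proof (rule degree_lessI)
    show "\<forall>k\<ge>?q. poly.coeff ?p k = 0"
    proof (intro allI impI)
      fix k assume k: "?q \<le> k"
      show "poly.coeff ?p k = 0"
      proof (cases "k = ?q")
        case True
        thus ?thesis using card_field_ge_2[where 'k='k] coeff[of ?q] by simp
      next
        case False
        with k have "degree ([:1, 1::'k:] ^ ?q) < k" by (simp add: degree_linear_power)
        thus ?thesis using False k by (simp add: coeff_eq_0)
      qed
    qed
  qed (use card_field_ge_2[where 'k='k] in auto)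
  moreover have "{x. poly ?p x = 0} = UNIV" by (auto simp: poly_monom algebra_simps)
  ultimately have "?p = 0" using card_poly_roots_bound[of ?p] by fastforce
  hence "poly.coeff ([:1, 1::'k:] ^ ?q) i = poly.coeff (Polynomial.monom 1 ?q + 1) i" by simp
  thus ?thesis using assms coeff[of i] by simp
qed

section \<open>Powers of q in the ambient ring, q-th roots, and the integer powers of
  Frobenius\<close>

lemma of_nat_hpoly: "(of_nat m :: ('k::{field,finite}) hpoly) = Poly_Mapping.single 0 (of_nat m)"
  by simp

lemma hpoly_power_card_add:
  fixes a b :: "('k::{field,finite}) hpoly"
  shows "(a + b) ^ CARD('k) = a ^ CARD('k) + b ^ CARD('k)"
proof -
  let ?q = "CARD('k)"
  have "(a + b) ^ ?q = (\<Sum>i\<le>?q. of_nat (?q choose i) * a ^ i * b ^ (?q - i))"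
    by (rule binomial_ring)
  also have "\<dots> = (\<Sum>i\<in>{0, ?q}. of_nat (?q choose i) * a ^ i * b ^ (?q - i))"
  proof (rule sum.mono_neutral_right)
    show "\<forall>i\<in>{..?q} - {0, ?q}. of_nat (?q choose i) * a ^ i * b ^ (?q - i) = 0"
    proof
      fix i assume "i \<in> {..?q} - {0, ?q}"
      hence "of_nat (?q choose i) = (0::'k)" by (intro of_nat_binomial_card_field) auto
      hence "of_nat (?q choose i) = (0::'k hpoly)" unfolding of_nat_hpoly by simp
      thus "of_nat (?q choose i) * a ^ i * b ^ (?q - i) = 0" by simp
    qed
  qed auto
  also have "\<dots> = a ^ ?q + b ^ ?q" using card_field_ge_2[where 'k='k] by simp
  finally show ?thesis .
qed

lemma hpoly_power_card_power_add:
  fixes a b :: "('k::{field,finite}) hpoly"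
  shows "(a + b) ^ (CARD('k) ^ n) = a ^ (CARD('k) ^ n) + b ^ (CARD('k) ^ n)"
proof (induction n)
  case (Suc n)
  thus ?case by (simp only: power_Suc mult.commute[of "CARD('k)"] power_mult hpoly_power_card_add)
qed simp

lemma hpoly_power_card_power_0 [simp]:
  "(0::('k::{field,finite}) hpoly) ^ (CARD('k) ^ n) = 0"
  using card_field_ge_2[where 'k='k] by (auto simp: zero_power)

lemma hpoly_power_card_power_uminus:
  fixes a :: "('k::{field,finite}) hpoly"
  shows "(- a) ^ (CARD('k) ^ n) = - (a ^ (CARD('k) ^ n))"
  using hpoly_power_card_power_add[of a "- a" n]
  by (simp add: eq_neg_iff_add_eq_0 add.commute)

lemma hpoly_power_card_power_diff:
  fixes a b :: "('k::{field,finite}) hpoly"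
  shows "(a - b) ^ (CARD('k) ^ n) = a ^ (CARD('k) ^ n) - b ^ (CARD('k) ^ n)"
  using hpoly_power_card_power_add[of a "- b" n] by (simp add: hpoly_power_card_power_uminus)

text \<open>The ring has no zero divisors, so a - b is zero once a power of it is. This makes the
  root chosen by \<open>THE\<close> in \<open>frob\<close> unique.\<close>

lemma hpoly_power_card_power_inject:
  fixes a b :: "('k::{field,finite}) hpoly"
  shows "a ^ (CARD('k) ^ n) = b ^ (CARD('k) ^ n) \<longleftrightarrow> a = b"
proof
  assume "a ^ (CARD('k) ^ n) = b ^ (CARD('k) ^ n)"
  hence "(a - b) ^ (CARD('k) ^ n) = 0" by (simp add: hpoly_power_card_power_diff)
  thus "a = b" by simp
qed simp

lemma single_power:
  "Poly_Mapping.single m c ^ n = Poly_Mapping.single (\<Sum>i<n. m) (c ^ n)"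
  by (induction n) (simp_all add: mult_single add.commute)

lemma single_monomial_root:
  fixes c :: "'k::{field,finite}" and m :: "nat \<Rightarrow>\<^sub>0 rat"
  shows "\<exists>v. v ^ CARD('k) = Poly_Mapping.single m c"
proof -
  let ?q = "CARD('k)"
  let ?m = "Poly_Mapping.map (\<lambda>x. x / of_nat ?q) m"
  have "(\<Sum>i<?q. ?m) = m"
  proof (rule poly_mapping_eqI)
    fix i
    show "Poly_Mapping.lookup (\<Sum>i<?q. ?m) i = Poly_Mapping.lookup m i"
      using card_field_ge_2[where 'k='k]
      by (simp add: lookup_sum Poly_Mapping.map.rep_eq when_def del: sum_constant) simp
  qed
  hence "Poly_Mapping.single ?m c ^ ?q = Poly_Mapping.single m c" by (simp add: single_power)
  thus ?thesis by blast
qed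

text \<open>Rational exponents can be divided by q and each coefficient is its own q-th root, so
  monomials have roots; additivity of the q-th power extends this to sums.\<close>

lemma hpoly_root_exists:
  fixes u :: "('k::{field,finite}) hpoly"
  shows "\<exists>v. v ^ (CARD('k) ^ n) = u"
proof -
  have step: "\<exists>v. v ^ CARD('k) = u" for u :: "'k hpoly"
  proof (induction u rule: update_induct)
    case const
    show ?case using hpoly_power_card_power_0[where 'k='k, of 1] by auto
  next
    case (update f a b)
    have "Poly_Mapping.update a b f = f + Poly_Mapping.single a b"
      by (rule poly_mapping_eqI)
        (use update in \<open>auto simp: lookup_update lookup_add lookup_single when_def in_keys_iff\<close>)
    moreover obtain v where "v ^ CARD('k) = f" using update by blast
    moreover obtain w where "w ^ CARD('k) = Poly_Mapping.single a b"
      using single_monomial_root by blast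
    ultimately show ?case using hpoly_power_card_add by metis
  qed
  show ?thesis
  proof (induction n arbitrary: u)
    case (Suc n)
    obtain w where "w ^ CARD('k) = u" using step by blast
    moreover obtain v where "v ^ (CARD('k) ^ n) = w" using Suc by blast
    ultimately show ?case by (auto simp: power_mult mult.commute[of "CARD('k)"])
  qed simp
qed

lemma frob_of_nat: "frob (int n) (u::('k::{field,finite}) hpoly) = u ^ (CARD('k) ^ n)"
  by (simp add: frob_def)

lemma frob_0 [simp]: "frob 0 u = (u::('k::{field,finite}) hpoly)"
  by (simp add: frob_def)

lemma frob_neg_power: "frob (- int n) u ^ (CARD('k) ^ n) = (u::('k::{field,finite}) hpoly)"
proof (cases "n = 0")
  case False
  obtain v where v: "v ^ (CARD('k) ^ n) = u" using hpoly_root_exists by blast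
  have "frob (- int n) u = (THE v. v ^ (CARD('k) ^ n) = u)"
    using False by (simp add: frob_def)
  also have "\<dots> = v"
    by (rule the_equality) (use v in \<open>auto simp: hpoly_power_card_power_inject\<close>)
  finally show ?thesis using v by simp
qed simp

text \<open>Turns a twist of either sign into an equation between nonnegative powers. The laws of
  \<open>frob\<close> are proved through it by writing the twist as a difference of
  naturals.\<close>

lemma frob_diff_nat_iff:
  fixes u v :: "('k::{field,finite}) hpoly"
  shows "frob (int m - int n) u = v \<longleftrightarrow> u ^ (CARD('k) ^ m) = v ^ (CARD('k) ^ n)"
proof (cases "n \<le> m")
  case True
  then obtain l where l: "m = n + l" using le_Suc_ex by blast
  have "u ^ (CARD('k) ^ m) = (u ^ (CARD('k) ^ l)) ^ (CARD('k) ^ n)"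
    unfolding l by (simp add: power_add power_mult[symmetric] mult.commute)
  moreover have "frob (int m - int n) u = u ^ (CARD('k) ^ l)"
    unfolding l by (simp add: frob_def)
  ultimately show ?thesis by (simp add: hpoly_power_card_power_inject)
next
  case False
  then obtain l where l: "n = m + l" using le_Suc_ex nat_le_linear by blast
  have "v ^ (CARD('k) ^ n) = (v ^ (CARD('k) ^ l)) ^ (CARD('k) ^ m)"
    unfolding l by (simp add: power_add power_mult[symmetric] mult.commute)
  hence "u ^ (CARD('k) ^ m) = v ^ (CARD('k) ^ n) \<longleftrightarrow> u = v ^ (CARD('k) ^ l)"
    by (simp add: hpoly_power_card_power_inject)
  also have "\<dots> \<longleftrightarrow> frob (- int l) u ^ (CARD('k) ^ l) = v ^ (CARD('k) ^ l)"
    by (simp add: frob_neg_power)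
  also have "\<dots> \<longleftrightarrow> frob (- int l) u = v" by (rule hpoly_power_card_power_inject)
  finally show ?thesis unfolding l by simp
qed

lemma frob_diff_nat_power:
  "frob (int m - int n) (u::('k::{field,finite}) hpoly) ^ (CARD('k) ^ n) = u ^ (CARD('k) ^ m)"
  using frob_diff_nat_iff[of m n u "frob (int m - int n) u"] by simp

lemma frob_frob: "frob a (frob b u) = frob (a + b) (u::('k::{field,finite}) hpoly)"
proof -
  obtain m n where a: "a = int m - int n" by (rule int_diff_cases)
  obtain k l where b: "b = int k - int l" by (rule int_diff_cases)
  have ab: "a + b = int (m + k) - int (n + l)" using a b by simp
  let ?q = "CARD('k)"
  have "u ^ (?q ^ (m + k)) = (u ^ (?q ^ k)) ^ (?q ^ m)"
    by (simp add: power_mult[symmetric] power_add mult.commute)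
  also have "\<dots> = (frob b u ^ (?q ^ l)) ^ (?q ^ m)" unfolding b frob_diff_nat_power ..
  also have "\<dots> = (frob b u ^ (?q ^ m)) ^ (?q ^ l)"
    by (simp add: power_mult[symmetric] mult.commute)
  also have "\<dots> = (frob a (frob b u) ^ (?q ^ n)) ^ (?q ^ l)" unfolding a frob_diff_nat_power ..
  also have "\<dots> = frob a (frob b u) ^ (?q ^ (n + l))"
    by (simp add: power_mult[symmetric] power_add)
  finally show ?thesis unfolding ab frob_diff_nat_iff[symmetric] by simp
qed

lemma frob_add: "frob a (u + v) = frob a u + frob a (v::('k::{field,finite}) hpoly)"
proof -
  obtain m n where a: "a = int m - int n" by (rule int_diff_cases)
  show ?thesis unfolding a
    by (simp add: frob_diff_nat_iff hpoly_power_card_power_add frob_diff_nat_power)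
qed

lemma frob_mult: "frob a (u * v) = frob a u * frob a (v::('k::{field,finite}) hpoly)"
proof -
  obtain m n where a: "a = int m - int n" by (rule int_diff_cases)
  show ?thesis unfolding a
    by (simp add: frob_diff_nat_iff power_mult_distrib frob_diff_nat_power)
qed

lemma frob_1 [simp]: "frob a (1::('k::{field,finite}) hpoly) = 1"
proof -
  obtain m n where a: "a = int m - int n" by (rule int_diff_cases)
  show ?thesis unfolding a by (simp add: frob_diff_nat_iff)
qed

lemma frob_zero [simp]: "frob a (0::('k::{field,finite}) hpoly) = 0"
  using frob_add[of a 0 0] by (simp only: add_0_right add_cancel_right_right)

lemma frob_uminus: "frob a (- u) = - frob a (u::('k::{field,finite}) hpoly)"
  using frob_add[of a u "- u"] by (simp add: eq_neg_iff_add_eq_0 add.commute)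

lemma frob_diff: "frob a (u - v) = frob a u - frob a (v::('k::{field,finite}) hpoly)"
  using frob_add[of a u "- v"] by (simp add: frob_uminus)

lemma frob_power: "frob a (u ^ n) = frob a (u::('k::{field,finite}) hpoly) ^ n"
  by (induction n) (simp_all add: frob_mult)

lemma smul_power_card_power:
  "smul c u ^ (CARD('k) ^ n) = smul c ((u::('k::{field,finite}) hpoly) ^ (CARD('k) ^ n))"
  by (simp add: smul_def power_mult_distrib single_power)

lemma frob_smul: "frob a (smul c u) = smul c (frob a (u::('k::{field,finite}) hpoly))"
proof -
  obtain m n where a: "a = int m - int n" by (rule int_diff_cases)
  show ?thesis unfolding a
    by (simp add: frob_diff_nat_iff smul_power_card_power frob_diff_nat_power)
qed

subsection \<open>Subspaces and q-polynomials\<close>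

interpretation hv: vector_space "smul :: 'k::{field,finite} \<Rightarrow> 'k hpoly \<Rightarrow> 'k hpoly"
  by unfold_locales (simp_all add: smul_def algebra_simps single_add mult_single flip: mult.assoc)

lemma smul_mult_right: "u * smul c v = smul c (u * v)"
  by (simp add: smul_def mult.left_commute)

lemma linear_smul_iff:
  "Vector_Spaces.linear smul smul (f :: 'k::{field,finite} hpoly \<Rightarrow> 'k hpoly) \<longleftrightarrow>
     (\<forall>x y. f (x + y) = f x + f y) \<and> (\<forall>c x. f (smul c x) = smul c (f x))"
  by (simp add: Vector_Spaces.linear_iff hv.vector_space_axioms)

text \<open>Serves both to count a span and to sum over it, by induction on the basis.\<close>

lemma bij_betw_span_insert:
  fixes B :: "('k::{field,finite}) hpoly set"
  assumes b: "b \<notin> hv.span B"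
  shows "bij_betw (\<lambda>(c, x). smul c b + x) (UNIV \<times> hv.span B) (hv.span (insert b B))"
proof -
  let ?f = "\<lambda>(c, x). smul c b + x"
  have "hv.span (insert b B) = ?f ` (UNIV \<times> hv.span B)"
  proof (intro equalityI subsetI)
    fix x assume "x \<in> hv.span (insert b B)"
    then obtain c where "x - smul c b \<in> hv.span B" by (auto simp: hv.span_insert)
    thus "x \<in> ?f ` (UNIV \<times> hv.span B)" by (intro image_eqI[of _ _ "(c, x - smul c b)"]) auto
  qed (auto simp: hv.span_insert, metis add_diff_cancel_left')
  moreover have "inj_on ?f (UNIV \<times> hv.span B)"
  proof (rule inj_onI, clarsimp)
    fix c d x y
    assume xy: "x \<in> hv.span B" "y \<in> hv.span B" and eq: "smul c b + x = smul d b + y"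
    have "smul (c - d) b = y - x" using eq by (simp add: hv.scale_left_diff_distrib algebra_simps)
    hence *: "smul (c - d) b \<in> hv.span B" using xy by (simp add: hv.span_diff)
    have "c = d"
    proof (rule ccontr)
      assume "c \<noteq> d"
      hence "b = smul (inverse (c - d)) (smul (c - d) b)" by simp
      thus False using b * by (metis hv.span_scale)
    qed
    thus "c = d \<and> x = y" using eq by simp
  qed
  ultimately show ?thesis by (simp add: bij_betw_def)
qed

lemma finite_card_span_independent:
  fixes B :: "('k::{field,finite}) hpoly set"
  assumes "finite B" "hv.independent B"
  shows "finite (hv.span B) \<and> card (hv.span B) = CARD('k) ^ card B"
  using assms
proof (induction B rule: finite_induct)
  case (insert b B)
  have indep: "hv.independent B" "b \<notin> hv.span B"
    using insert.prems insert.hyps(2) hv.independent_insert[of b B] by auto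
  note bij = bij_betw_span_insert[OF indep(2)]
  have IH: "finite (hv.span B)" "card (hv.span B) = CARD('k) ^ card B"
    using insert.IH indep by auto
  show ?case
    using bij_betw_finite[OF bij] bij_betw_same_card[OF bij] IH insert.hyps
    by (simp add: card_cartesian_product)
qed simp

lemma fin_dim_basis:
  fixes W :: "('k::{field,finite}) hpoly set"
  assumes "fin_dim W"
  obtains ws where "distinct ws" "hv.independent (set ws)" "hv.span (set ws) = W" "length ws = fdim W"
proof -
  obtain B where B: "finite B" "hv.span B = W" using assms by (auto simp: fin_dim_def)
  obtain C where C: "C \<subseteq> B" "hv.independent C" "B \<subseteq> hv.span C"
    using hv.maximal_independent_subset[of B] by metis
  have span: "hv.span C = W"
    using B C hv.span_mono[of C B] hv.span_minimal[of B "hv.span C"] by auto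
  obtain ws where ws: "distinct ws" "set ws = C"
    using finite_distinct_list[of C] finite_subset[OF C(1) B(1)] by auto
  have "length ws = fdim W"
    using ws C(2) span hv.dim_span_eq_card_independent[of C] by (auto simp flip: distinct_card)
  thus thesis using that ws C(2) span by simp
qed

lemma fin_dim_fbasis:
  fixes W :: "('k::{field,finite}) hpoly set"
  assumes "fin_dim W"
  shows "distinct (fbasis W)" "hv.independent (set (fbasis W))" "hv.span (set (fbasis W)) = W"
    "length (fbasis W) = fdim W"
proof -
  obtain ws where ws: "distinct ws" "hv.independent (set ws)" "hv.span (set ws) = W"
    using fin_dim_basis[OF assms] by metis
  let ?P = "\<lambda>ws. distinct ws \<and> hv.independent (set ws) \<and> hv.span (set ws) = W"
  have *: "?P (fbasis W)" unfolding fbasis_def by (rule someI[of ?P ws]) (use ws in auto)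
  thus "distinct (fbasis W)" "hv.independent (set (fbasis W))" "hv.span (set (fbasis W)) = W"
    by auto
  show "length (fbasis W) = fdim W"
    using * hv.dim_span_eq_card_independent[of "set (fbasis W)"] by (auto simp: distinct_card)
qed

lemma fin_dim_subspace: "fin_dim W \<Longrightarrow> hv.subspace W"
  by (auto simp: fin_dim_def)

lemma finite_card_fin_dim:
  fixes W :: "('k::{field,finite}) hpoly set"
  assumes "fin_dim W"
  shows "finite W" "card W = CARD('k) ^ fdim W"
  using finite_card_span_independent[of "set (fbasis W)"] fin_dim_fbasis[OF assms]
  by (auto simp: distinct_card)

section \<open>q-polynomials: vanishing, annihilators, reduction of high powers\<close>

lemma hpoly_power_card_power_sum:
  fixes f :: "'i \<Rightarrow> ('k::{field,finite}) hpoly"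
  shows "(\<Sum>i\<in>A. f i) ^ (CARD('k) ^ n) = (\<Sum>i\<in>A. f i ^ (CARD('k) ^ n))"
  by (induction A rule: infinite_finite_induct) (simp_all add: hpoly_power_card_power_add)

lemma linear_qfun:
  "Vector_Spaces.linear smul smul
     (\<lambda>w::('k::{field,finite}) hpoly. \<Sum>i\<in>I. c i * w ^ (CARD('k) ^ e i))"
  by (simp add: linear_smul_iff hpoly_power_card_power_add smul_power_card_power smul_mult_right
      distrib_left sum.distrib hv.scale_sum_right)

lemma subspace_qfun_zeros:
  "hv.subspace {w::('k::{field,finite}) hpoly. (\<Sum>i\<in>I. c i * w ^ (CARD('k) ^ e i)) = 0}"
  using linear_qfun[of c e I] unfolding linear_smul_iff
  by (auto simp: hv.subspace_def zero_power[OF zero_less_power[OF zero_less_card_finite]])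

text \<open>The polynomial behind the sum has degree below q^d and the q^d elements of W among its
  roots, so it is zero; its exponents are distinct, so each coefficient can be read off.\<close>

lemma qfun_coeff_eq_0:
  fixes c :: "nat \<Rightarrow> ('k::{field,finite}) hpoly"
  assumes W: "fin_dim W"
    and zero: "\<And>w. w \<in> W \<Longrightarrow> (\<Sum>i<fdim W. c i * w ^ (CARD('k) ^ i)) = 0"
    and i: "i < fdim W"
  shows "c i = 0"
proof -
  let ?q = "CARD('k)"
  let ?d = "fdim W"
  let ?p = "\<Sum>i<?d. Polynomial.monom (c i) (?q ^ i)"
  have q: "2 \<le> ?q" by (rule card_field_ge_2)
  have "degree ?p < ?q ^ ?d"
  proof (rule degree_sum_less)
    fix j assume "j \<in> {..<?d}"
    hence "?q ^ j < ?q ^ ?d" using q by (intro power_strict_increasing) auto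
    thus "degree (Polynomial.monom (c j) (?q ^ j)) < ?q ^ ?d"
      using degree_monom_le[of "c j" "?q ^ j"] by linarith
  qed (use q in auto)
  moreover have "card {x. poly ?p x = 0} \<ge> ?q ^ ?d" if "?p \<noteq> 0"
  proof -
    have "card W \<le> card {x. poly ?p x = 0}"
      by (rule card_mono) (use poly_roots_finite[OF that] zero in \<open>auto simp: poly_sum poly_monom\<close>)
    thus ?thesis using finite_card_fin_dim[OF W] by simp
  qed
  ultimately have "?p = 0" using card_poly_roots_bound[of ?p] by fastforce
  hence "0 = poly.coeff ?p (?q ^ i)" by simp
  also have "\<dots> = (\<Sum>j<?d. if j = i then c j else 0)"
    unfolding coeff_sum by (rule sum.cong) (use q in \<open>auto simp: power_inject_exp\<close>)
  also have "\<dots> = c i" using i by simp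
  finally show ?thesis by simp
qed

lemma qfun_coeff_unique:
  fixes c c' :: "nat \<Rightarrow> ('k::{field,finite}) hpoly"
  assumes "fin_dim W"
    and "\<And>w. w \<in> W \<Longrightarrow> (\<Sum>i<fdim W. c i * w ^ (CARD('k) ^ i)) = (\<Sum>i<fdim W. c' i * w ^ (CARD('k) ^ i))"
    and "i < fdim W"
  shows "c i = c' i"
  using qfun_coeff_eq_0[of W "\<lambda>i. c i - c' i" i] assms
  by (simp add: left_diff_distrib sum_subtractf)

text \<open>Adds one generator at a time: if g kills the old span, then g^q - g(a)^(q-1) g kills
  both the old span and a, and it is again monic.\<close>

lemma qfun_annihilator:
  fixes ws :: "('k::{field,finite}) hpoly list"
  shows "\<exists>c. c (length ws) = 1 \<and>
     (\<forall>w\<in>hv.span (set ws). (\<Sum>j\<le>length ws. c j * w ^ (CARD('k) ^ j)) = 0)"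
proof (induction ws)
  case Nil
  show ?case by (rule exI[of _ "\<lambda>_. 1"]) simp
next
  case (Cons a ws)
  let ?q = "CARD('k)"
  let ?n = "length ws"
  obtain c where c: "c ?n = 1" "\<And>w. w \<in> hv.span (set ws) \<Longrightarrow> (\<Sum>j\<le>?n. c j * w ^ (?q ^ j)) = 0"
    using Cons.IH by blast
  define g where "g w = (\<Sum>j\<le>?n. c j * w ^ (?q ^ j))" for w
  \<comment> \<open>Coefficients of g^q - g(a)^(q-1) g: the q-th power shifts each index by one, the
    second term keeps it.\<close>
  define c' where "c' j = (case j of 0 \<Rightarrow> 0 | Suc i \<Rightarrow> c i ^ ?q) -
      (if j \<le> ?n then g a ^ (?q - 1) * c j else 0)" for j
  have g': "(\<Sum>j\<le>Suc ?n. c' j * w ^ (?q ^ j)) = g w ^ ?q - g a ^ (?q - 1) * g w" for w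
  proof -
    have "(\<Sum>j\<le>Suc ?n. (case j of 0 \<Rightarrow> 0 | Suc i \<Rightarrow> c i ^ ?q) * w ^ (?q ^ j)) = g w ^ ?q"
      using hpoly_power_card_power_sum[where 'k='k and n=1 and f="\<lambda>j. c j * w ^ (?q ^ j)" and A="{..?n}"]
      by (subst sum.atMost_Suc_shift)
        (simp add: g_def power_mult_distrib power_mult[symmetric] mult.commute)
    moreover have "(\<Sum>j\<le>Suc ?n. (if j \<le> ?n then g a ^ (?q - 1) * c j else 0) * w ^ (?q ^ j)) =
        g a ^ (?q - 1) * g w"
      by (simp add: g_def sum_distrib_left mult.assoc)
    ultimately show ?thesis unfolding c'_def by (simp only: left_diff_distrib sum_subtractf)
  qed
  have q: "Suc (?q - 1) = ?q" using card_field_ge_2[where 'k='k] by simp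
  have "hv.span (set (a # ws)) \<subseteq> {w. (\<Sum>j\<le>Suc ?n. c' j * w ^ (?q ^ j)) = 0}"
  proof (rule hv.span_minimal[OF _ subspace_qfun_zeros], rule subsetI)
    fix w assume "w \<in> set (a # ws)"
    moreover have "g a ^ ?q - g a ^ (?q - 1) * g a = 0"
      using power_Suc[of "g a" "?q - 1"] unfolding q by (simp add: mult.commute)
    moreover have "g w ^ ?q - g a ^ (?q - 1) * g w = 0" if "w \<in> set ws"
    proof -
      have "g w = 0" unfolding g_def using c(2) hv.span_base[OF that] by blast
      thus ?thesis by (simp add: zero_power)
    qed
    ultimately show "w \<in> {w. (\<Sum>j\<le>Suc ?n. c' j * w ^ (?q ^ j)) = 0}" unfolding mem_Collect_eq g' by auto
  qed
  moreover have "c' (Suc ?n) = 1" using c(1) by (simp add: c'_def)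
  ultimately show ?case by (intro exI[of _ c']) auto
qed

lemma sum_unit_vector:
  fixes f :: "nat \<Rightarrow> 'a::comm_ring_1"
  assumes "m < d"
  shows "(\<Sum>j<d. (if j = m then 1 else 0) * f j) = f m"
proof -
  have "(\<Sum>j<d. (if j = m then 1 else 0) * f j) = (\<Sum>j<d. if j = m then f j else 0)"
    by (rule sum.cong) auto
  thus ?thesis using assms by simp
qed

text \<open>Induction on m by taking q-th powers and reducing again. The coefficients turn out to be
  the functions in question: for m = r + d - 1 the one at index d - 1 is H_r, and for m = d they are
  the E_r up to sign.\<close>

lemma qfun_reduce_exists:
  fixes W :: "('k::{field,finite}) hpoly set"
  assumes W: "fin_dim W"
  shows "\<exists>c. \<forall>w\<in>W. w ^ (CARD('k) ^ m) = (\<Sum>j<fdim W. c j * w ^ (CARD('k) ^ j))"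
proof (induction m)
  let ?q = "CARD('k)"
  let ?d = "fdim W"
  let ?red = "\<lambda>m. \<exists>c. \<forall>w\<in>W. w ^ (?q ^ m) = (\<Sum>j<?d. c j * w ^ (?q ^ j))"
  have small: "?red m" if "m < ?d" for m
    using that by (intro exI[of _ "\<lambda>j. if j = m then 1 else 0"]) (simp add: sum_unit_vector)
  have dd: "?red ?d"
  proof -
    obtain ws where ws: "hv.span (set ws) = W" "length ws = fdim W"
      using fin_dim_basis[OF W] by metis
    then obtain c where c: "c ?d = 1" "\<And>w. w \<in> W \<Longrightarrow> (\<Sum>j\<le>?d. c j * w ^ (?q ^ j)) = 0"
      using qfun_annihilator[of ws] by auto
    have "w ^ (?q ^ ?d) = (\<Sum>j<?d. - c j * w ^ (?q ^ j))" if "w \<in> W" for w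
      using c(2)[OF that] c(1)
      by (simp add: lessThan_Suc_atMost[symmetric] sum_negf eq_neg_iff_add_eq_0 add.commute)
    thus ?thesis by (intro exI[of _ "\<lambda>j. - c j"]) blast
  qed
  have le: "?red m" if "m \<le> ?d" for m using that small dd le_eq_less_or_eq by blast
  show "?red 0" by (rule le) simp
  fix m assume "?red m"
  then obtain c where c: "\<And>w. w \<in> W \<Longrightarrow> w ^ (?q ^ m) = (\<Sum>j<?d. c j * w ^ (?q ^ j))" by blast
  \<comment> \<open>The q-th power raises the exponents below d by one, so reductions
    \<open>r k\<close> for k up to and including d suffice.\<close>
  have "\<exists>r. \<forall>k\<in>{..?d}. \<forall>w\<in>W. w ^ (?q ^ k) = (\<Sum>j<?d. r k j * w ^ (?q ^ j))"
    by (rule bchoice) (use le in blast)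
  then obtain r where r: "\<And>k w. k \<le> ?d \<Longrightarrow> w \<in> W \<Longrightarrow> w ^ (?q ^ k) = (\<Sum>j<?d. r k j * w ^ (?q ^ j))"
    by blast
  have "w ^ (?q ^ Suc m) = (\<Sum>j<?d. (\<Sum>i<?d. c i ^ ?q * r (Suc i) j) * w ^ (?q ^ j))" if "w \<in> W" for w
  proof -
    have "w ^ (?q ^ Suc m) = (w ^ (?q ^ m)) ^ (?q ^ 1)" by (simp add: power_mult[symmetric] mult.commute)
    also have "\<dots> = (\<Sum>i<?d. (c i * w ^ (?q ^ i)) ^ (?q ^ 1))"
      unfolding c[OF that] by (rule hpoly_power_card_power_sum)
    also have "\<dots> = (\<Sum>i<?d. c i ^ ?q * w ^ (?q ^ Suc i))"
      by (simp add: power_mult_distrib power_mult[symmetric] mult.commute)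
    also have "\<dots> = (\<Sum>i<?d. c i ^ ?q * (\<Sum>j<?d. r (Suc i) j * w ^ (?q ^ j)))"
      by (intro sum.cong refl arg_cong2[of _ _ _ _ "(*)"] r that) simp
    also have "\<dots> = (\<Sum>j<?d. (\<Sum>i<?d. c i ^ ?q * r (Suc i) j) * w ^ (?q ^ j))"
      unfolding sum_distrib_left sum_distrib_right mult.assoc by (rule sum.swap)
    finally show ?thesis .
  qed
  thus "?red (Suc m)" by (intro exI[of _ "\<lambda>j. \<Sum>i<?d. c i ^ ?q * r (Suc i) j"]) blast
qed

interpretation hvp: vector_space_pair "smul :: 'k::{field,finite} \<Rightarrow> 'k hpoly \<Rightarrow> 'k hpoly"
  "smul :: 'k::{field,finite} \<Rightarrow> 'k hpoly \<Rightarrow> 'k hpoly" ..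

section \<open>Moore determinants; H and E as reduction coefficients\<close>

lemma moore_map:
  "moore (ws::('k::{field,finite}) hpoly list) (map e [0..<length ws]) =
     det (mat (length ws) (length ws) (\<lambda>(i, j). ws ! i ^ (CARD('k) ^ e j)))"
  unfolding moore_def by (intro arg_cong[of _ _ det] eq_matI) auto

text \<open>A kernel vector of the Moore matrix, read backwards, lists the coefficients of a
  q-polynomial with exponents below q^d that vanishes on W, so it is zero.\<close>

lemma moore_delta_nonzero:
  fixes ws :: "('k::{field,finite}) hpoly list"
  assumes W: "fin_dim W" and ws: "hv.span (set ws) = W" "length ws = fdim W"
  shows "moore ws (map (\<lambda>j. length ws - 1 - j) [0..<length ws]) \<noteq> 0"
proof
  let ?q = "CARD('k)"
  let ?d = "length ws"
  let ?A = "mat ?d ?d (\<lambda>(i, j). ws ! i ^ (?q ^ (?d - 1 - j)))"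
  assume "moore ws (map (\<lambda>j. length ws - 1 - j) [0..<length ws]) = 0"
  hence "det ?A = 0" unfolding moore_map .
  then obtain v where v: "v \<in> carrier_vec ?d" "v \<noteq> 0\<^sub>v ?d" "?A *\<^sub>v v = 0\<^sub>v ?d"
    using det_0_iff_vec_prod_zero[of ?A ?d] by auto
  let ?g = "\<lambda>w. \<Sum>j<?d. v $ (?d - Suc j) * w ^ (?q ^ j)"
  have "?g (ws ! i) = 0" if "i < ?d" for i
  proof -
    have "0 = (?A *\<^sub>v v) $ i" using v(3) that by simp
    also have "\<dots> = (\<Sum>j<?d. v $ j * (ws ! i) ^ (?q ^ (?d - Suc j)))"
      using that v(1) by (simp add: scalar_prod_def atLeast0LessThan mult.commute)
    also have "\<dots> = ?g (ws ! i)"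
      by (subst sum.nat_diff_reindex[symmetric]) (rule sum.cong, auto simp: Suc_diff_Suc)
    finally show ?thesis by simp
  qed
  hence "hv.span (set ws) \<subseteq> {w. ?g w = 0}"
    by (intro hv.span_minimal subspace_qfun_zeros) (auto simp: in_set_conv_nth)
  hence "\<And>w. w \<in> W \<Longrightarrow> (\<Sum>j<fdim W. v $ (?d - Suc j) * w ^ (?q ^ j)) = 0" using ws by auto
  hence zero: "v $ (?d - Suc j) = 0" if "j < ?d" for j
    using qfun_coeff_eq_0[OF W, of "\<lambda>j. v $ (?d - Suc j)" j] that ws(2) by auto
  have "v $ j = 0" if "j < ?d" for j using zero[of "?d - Suc j"] that by simp
  hence "v = 0\<^sub>v ?d" using v(1) by (intro eq_vecI) auto
  thus False using v(2) by simp
qed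

text \<open>The denominator is nonzero, so the product identity alone determines the value hidden in
  \<open>THE\<close>.\<close>

lemma schurW_eqI:
  fixes W :: "('k::{field,finite}) hpoly set"
  assumes W: "fin_dim W"
    and "s * moore (fbasis W) (map (\<lambda>j. fdim W - 1 - j) [0..<fdim W]) =
      moore (fbasis W) (map (\<lambda>j. lam ! j + (fdim W - 1 - j)) [0..<fdim W])"
  shows "schurW W lam = s"
  unfolding schurW_def Let_def fin_dim_fbasis(4)[OF W]
proof (rule the_equality)
  have nz: "moore (fbasis W) (map (\<lambda>j. fdim W - 1 - j) [0..<fdim W]) \<noteq> 0"
    using moore_delta_nonzero[OF W fin_dim_fbasis(3,4)[OF W]] fin_dim_fbasis(4)[OF W] by simp
  show "s * moore (fbasis W) (map (\<lambda>j. fdim W - 1 - j) [0..<fdim W]) =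
      moore (fbasis W) (map (\<lambda>j. lam ! j + (fdim W - 1 - j)) [0..<fdim W])" by fact
  fix t
  assume "t * moore (fbasis W) (map (\<lambda>j. fdim W - 1 - j) [0..<fdim W]) =
      moore (fbasis W) (map (\<lambda>j. lam ! j + (fdim W - 1 - j)) [0..<fdim W])"
  thus "t = s" unfolding assms(2)[symmetric] by (rule iffD1[OF mult_right_cancel[OF nz]])
qed

text \<open>Cramer's rule: only the first column of the Moore matrix changes, and modulo the other
  columns the new one is \<open>c (d - 1)\<close> times the old one.\<close>

lemma Hq_eqI:
  fixes W :: "('k::{field,finite}) hpoly set"
  assumes W: "fin_dim W" and d: "0 < fdim W"
    and red: "\<And>w. w \<in> W \<Longrightarrow> w ^ (CARD('k) ^ (r + fdim W - 1)) = (\<Sum>j<fdim W. c j * w ^ (CARD('k) ^ j))"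
  shows "Hq W (int r) = c (fdim W - 1)"
proof -
  let ?q = "CARD('k)"
  let ?d = "fdim W"
  let ?ws = "fbasis W"
  note fb = fin_dim_fbasis[OF W]
  have wsW: "?ws ! i \<in> W" if "i < ?d" for i
    using that fb(3,4) hv.span_base[of "?ws ! i" "set ?ws"] by auto
  let ?A = "mat ?d ?d (\<lambda>(i, j). ?ws ! i ^ (?q ^ (?d - 1 - j)))"
  \<comment> \<open>Expresses the new columns through the old ones. Column 0 of \<open>?A\<close>
    carries exponent d - 1, so the coefficients of \<open>c\<close> appear in reverse order and
    \<open>c (d - 1)\<close> lands on the diagonal.\<close>
  let ?B = "mat ?d ?d (\<lambda>(l, j). if j = 0 then c (?d - 1 - l) else if l = j then 1 else 0)"
  let ?lam = "r # replicate (?d - 1) 0"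
  let ?A' = "mat ?d ?d (\<lambda>(i, j). ?ws ! i ^ (?q ^ (?lam ! j + (?d - 1 - j))))"
  have "?A' = ?A * ?B"
  proof (rule eq_matI)
    fix i j assume ij: "i < dim_row (?A * ?B)" "j < dim_col (?A * ?B)"
    have AB: "(?A * ?B) $$ (i, j) = (\<Sum>l<?d. ?ws ! i ^ (?q ^ (?d - Suc l)) * ?B $$ (l, j))"
      using ij by (simp add: scalar_prod_def atLeast0LessThan)
    show "?A' $$ (i, j) = (?A * ?B) $$ (i, j)"
    proof (cases "j = 0")
      case True
      have "(?A * ?B) $$ (i, j) = (\<Sum>l<?d. c (?d - Suc l) * ?ws ! i ^ (?q ^ (?d - Suc l)))"
        unfolding AB using True by (intro sum.cong) auto
      also have "\<dots> = (\<Sum>l<?d. c l * ?ws ! i ^ (?q ^ l))"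
        by (rule sum.nat_diff_reindex)
      also have "\<dots> = ?ws ! i ^ (?q ^ (r + ?d - 1))" using red wsW ij by simp
      finally show ?thesis using ij True d by simp
    next
      case False
      have "(?A * ?B) $$ (i, j) = (\<Sum>l<?d. if l = j then ?ws ! i ^ (?q ^ (?d - Suc l)) else 0)"
        unfolding AB using False ij by (intro sum.cong) auto
      also have "\<dots> = ?ws ! i ^ (?q ^ (?d - Suc j))" using ij by simp
      finally show ?thesis using ij False by (simp add: nth_Cons')
    qed
  qed auto
  moreover have "det ?B = c (?d - 1)"
  proof -
    have "det ?B = (\<Prod>l = 0..<?d. ?B $$ (l, l))"
      by (subst det_lower_triangular[of ?d]) (auto simp: prod_list_diag_prod)
    also have "\<dots> = (\<Prod>l = 0..<?d. if l = 0 then c (?d - 1) else 1)"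
      by (rule prod.cong) auto
    also have "\<dots> = c (?d - 1)" using d by (simp add: prod.delta)
    finally show ?thesis .
  qed
  ultimately have "det ?A' = c (?d - 1) * det ?A"
    using det_mult[of ?A ?d ?B] by (simp add: mult.commute)
  hence "schurW W ?lam = c (?d - 1)"
    using moore_map[of ?ws] fb(4) by (intro schurW_eqI[OF W]) simp
  thus ?thesis using d by (simp add: Hq_def)
qed

lemma Hq_0 [simp]:
  fixes W :: "('k::{field,finite}) hpoly set"
  assumes W: "fin_dim W"
  shows "Hq W 0 = 1"
proof (cases "fdim W = 0")
  case False
  have "Hq W (int 0) = (if fdim W - 1 = fdim W - 1 then 1 else 0)"
    by (rule Hq_eqI[OF W, where c = "\<lambda>j. if j = fdim W - 1 then 1 else 0"])
      (use False in \<open>auto simp: sum_unit_vector\<close>)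
  thus ?thesis by simp
qed (simp add: Hq_def)

text \<open>Expanding a determinant with a repeated row along that row gives a q-polynomial that
  vanishes on W and has as coefficients the Moore determinants with one exponent left out.
  Uniqueness of coefficients compares it with the given reduction.\<close>

lemma Eq_eqI:
  fixes W :: "('k::{field,finite}) hpoly set"
  assumes W: "fin_dim W"
    and red: "\<And>w. w \<in> W \<Longrightarrow> w ^ (CARD('k) ^ fdim W) = (\<Sum>j<fdim W. c j * w ^ (CARD('k) ^ j))"
  shows "Eq W 0 = 1"
    and "0 < r \<Longrightarrow> r \<le> fdim W \<Longrightarrow> (-1) ^ r * Eq W (int r) = - c (fdim W - r)"
proof -
  let ?q = "CARD('k)"
  let ?d = "fdim W"
  let ?ws = "fbasis W"
  note fb = fin_dim_fbasis[OF W]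
  let ?lam = "\<lambda>r. replicate r 1 @ replicate (?d - r) 0 :: nat list"
  let ?m = "\<lambda>r. moore ?ws (map (\<lambda>j. ?lam r ! j + (?d - 1 - j)) [0..<?d])"
  let ?D = "moore ?ws (map (\<lambda>j. ?d - 1 - j) [0..<?d])"
  have nz: "?D \<noteq> 0"
    using moore_delta_nonzero[OF W fb(3,4)] fb(4) by simp
  have m0: "?m 0 = ?D" by (intro arg_cong[of _ _ "moore ?ws"]) auto
  let ?g = "\<lambda>w. \<Sum>j<Suc ?d. ((-1) ^ (?d - j) * ?m (?d - j)) * w ^ (?q ^ j)"
  have zero_ws: "?g (?ws ! i) = 0" if i: "i < ?d" for i
  proof -
    \<comment> \<open>The last row repeats row i; the exponents run from d down to 0.\<close>
    let ?A = "mat (Suc ?d) (Suc ?d) (\<lambda>(l, j). (if l < ?d then ?ws ! l else ?ws ! i) ^ (?q ^ (?d - j)))"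
    have det0: "det ?A = 0"
      by (rule det_identical_rows[of _ "Suc ?d" i ?d]) (use i in auto)
    have laplace: "det ?A = (\<Sum>j<Suc ?d. ?A $$ (?d, j) * cofactor ?A ?d j)"
      by (rule laplace_expansion_row) auto
    have cof: "?A $$ (?d, j) * cofactor ?A ?d j =
        (-1) ^ ?d * (((-1) ^ j * ?m j) * ?ws ! i ^ (?q ^ (?d - j)))" if j: "j < Suc ?d" for j
    proof -
      \<comment> \<open>Leaving out exponent d - j raises the first j entries of d - 1, ..., 0 by
        one, which is the partition of j ones.\<close>
      have "mat_delete ?A ?d j =
          mat ?d ?d (\<lambda>(i', j'). ?ws ! i' ^ (?q ^ (?lam j ! j' + (?d - 1 - j'))))"
      proof (rule eq_matI, goal_cases)
        case (1 i' j')
        thus ?case using j by (auto simp: mat_delete_def nth_append)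
      qed (auto simp: mat_delete_def)
      hence "det (mat_delete ?A ?d j) = ?m j" using moore_map[of ?ws] fb(4) by simp
      thus ?thesis using j by (simp add: cofactor_def power_add mult_ac)
    qed
    have "(\<Sum>j<Suc ?d. (-1) ^ ?d * (((-1) ^ j * ?m j) * ?ws ! i ^ (?q ^ (?d - j)))) = 0"
      unfolding det0[symmetric] laplace by (intro sum.cong refl cof[symmetric]) (simp only: lessThan_iff)
    hence "(\<Sum>j<Suc ?d. ((-1) ^ j * ?m j) * ?ws ! i ^ (?q ^ (?d - j))) = 0"
      unfolding sum_distrib_left[symmetric] by simp
    also have "(\<Sum>j<Suc ?d. ((-1) ^ j * ?m j) * ?ws ! i ^ (?q ^ (?d - j))) = ?g (?ws ! i)"
      by (subst sum.nat_diff_reindex[symmetric]) (intro sum.cong, auto)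
    finally show ?thesis .
  qed
  hence "hv.span (set ?ws) \<subseteq> {w. ?g w = 0}"
    by (intro hv.span_minimal subspace_qfun_zeros) (auto simp: in_set_conv_nth fb(4))
  hence zero: "?g w = 0" if "w \<in> W" for w using that fb(3) by auto
  have coeff: "(-1) ^ (?d - j) * ?m (?d - j) = - (?D * c j)" if "j < ?d" for j
  proof (rule qfun_coeff_unique[OF W _ that])
    fix w assume w: "w \<in> W"
    have "(\<Sum>j<?d. ((-1) ^ (?d - j) * ?m (?d - j)) * w ^ (?q ^ j)) + ?D * w ^ (?q ^ ?d) = 0"
      using zero[OF w] m0 by simp
    thus "(\<Sum>j<?d. (-1) ^ (?d - j) * ?m (?d - j) * w ^ (?q ^ j)) = (\<Sum>j<?d. - (?D * c j) * w ^ (?q ^ j))"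
      unfolding red[OF w] by (simp add: sum_negf sum_distrib_left eq_neg_iff_add_eq_0 mult.assoc)
  qed
  have "schurW W (?lam 0) = 1" by (rule schurW_eqI[OF W]) (simp only: m0 mult_1_left)
  thus "Eq W 0 = 1" by (simp add: Eq_def)
  assume r: "0 < r" "r \<le> fdim W"
  have *: "(-1) ^ r * ?m r = - (?D * c (?d - r))" using coeff[of "?d - r"] r by simp
  have "?m r = (-1) ^ r * ((-1) ^ r * ?m r)" by (simp flip: mult.assoc power_mult_distrib)
  also have "\<dots> = (- ((-1) ^ r) * c (?d - r)) * ?D" unfolding * by (simp only: mult_minus_left mult_minus_right mult_ac)
  finally have eq: "?m r = (- ((-1) ^ r) * c (?d - r)) * ?D" .
  have "schurW W (?lam r) = - ((-1) ^ r) * c (?d - r)"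
    by (rule schurW_eqI[OF W eq[symmetric]])
  thus "(-1) ^ r * Eq W (int r) = - c (?d - r)"
    using r by (simp add: Eq_def flip: mult.assoc power_mult_distrib)
qed

section \<open>The map f_L of a line and the dimension of V/L\<close>

lemma card_line:
  fixes u :: "('k::{field,finite}) hpoly"
  assumes "u \<noteq> 0"
  shows "finite (hv.span {u})" "card (hv.span {u}) = CARD('k)"
  using finite_card_span_independent[of "{u}"] assms by auto

text \<open>As polynomials in v both sides are monic of degree q and vanish on the q elements of the
  line, so their difference has too many roots for its degree.\<close>

lemma prod_line:
  fixes u v :: "('k::{field,finite}) hpoly"
  assumes u: "u \<noteq> 0"
  shows "(\<Prod>x\<in>hv.span {u}. v + x) = v ^ CARD('k) - u ^ (CARD('k) - 1) * v"
proof -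
  let ?q = "CARD('k)"
  let ?L = "hv.span {u}"
  note L = card_line[OF u]
  have q: "2 \<le> ?q" by (rule card_field_ge_2)
  define p where "p = (\<Prod>x\<in>?L. [:x, 1:])"
  define r where "r = Polynomial.monom (1::'k hpoly) ?q - Polynomial.monom (u ^ (?q - 1)) 1"
  have degp: "degree p = ?q"
    unfolding p_def using L by (subst degree_prod_eq_sum_degree) auto
  have lcp: "poly.coeff p ?q = 1"
    using lead_coeff_prod[of "\<lambda>x. [:x, 1:]" ?L] degp unfolding p_def by simp
  have degr: "poly.coeff r k = (if k = ?q then 1 else 0)" if "k \<ge> ?q" for k
    using that q by (auto simp: r_def)
  have "degree (p - r) < ?q"
  proof (rule degree_lessI)
    show "\<forall>k\<ge>?q. poly.coeff (p - r) k = 0"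
      using degp lcp degr by (auto simp: coeff_eq_0)
  qed (use q in auto)
  moreover have "card {x. poly (p - r) x = 0} \<ge> ?q" if "p - r \<noteq> 0"
  proof -
    have "poly (p - r) x = 0" if x: "x \<in> ?L" for x
    proof -
      have "- x \<in> ?L" using x by (rule hv.span_neg)
      hence "poly p x = 0" unfolding p_def poly_prod using L(1)
        by (intro prod_zero) (auto intro!: bexI[of _ "- x"])
      moreover have "poly r x = 0"
      proof -
        obtain c where x: "x = smul c u" using x by (auto simp: hv.span_singleton)
        have "u ^ (?q - 1) * u = u ^ ?q" using power_minus_mult[of ?q u] q by simp
        thus ?thesis using smul_power_card_power[of c u 1]
          unfolding r_def x by (simp add: poly_monom smul_mult_right)
      qed
      ultimately show ?thesis by simp
    qed
    hence "card ?L \<le> card {x. poly (p - r) x = 0}"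
      using poly_roots_finite[OF that] by (intro card_mono) auto
    thus ?thesis using L by simp
  qed
  ultimately have "p - r = 0" using card_poly_roots_bound[of "p - r"] by fastforce
  hence "poly p v = poly r v" by simp
  thus ?thesis unfolding p_def r_def by (simp add: poly_prod poly_monom add.commute)
qed

lemma quotW_line:
  fixes V :: "('k::{field,finite}) hpoly set"
  assumes "u \<noteq> 0"
  shows "quotW V (hv.span {u}) = (\<lambda>v. v ^ CARD('k) - u ^ (CARD('k) - 1) * v) ` V"
  unfolding quotW_def prod_line[OF assms] ..

text \<open>Extend u to a basis of V. The kernel of f_L is the line, so f_L is injective on the span
  of the other basis vectors, and their images form a basis of the quotient.\<close>

lemma fin_dim_quotW_line:
  fixes V :: "('k::{field,finite}) hpoly set"
  assumes V: "fin_dim V" and u: "u \<in> V" "u \<noteq> 0"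
  shows "fin_dim (quotW V (hv.span {u}))" "Suc (fdim (quotW V (hv.span {u}))) = fdim V"
proof -
  let ?q = "CARD('k)"
  define f where "f v = v ^ ?q - u ^ (?q - 1) * v" for v
  have lin: "Vector_Spaces.linear smul smul f"
    using hpoly_power_card_power_add[where 'k='k and n=1] smul_power_card_power[where 'k='k and n=1]
    by (simp add: linear_smul_iff f_def distrib_left smul_mult_right hv.scale_right_diff_distrib)
  have ker: "x \<in> hv.span {u}" if "f x = 0" for x
  proof -
    have "(\<Prod>y\<in>hv.span {u}. x + y) = 0" using that prod_line[OF u(2)] by (simp add: f_def)
    then obtain y where "y \<in> hv.span {u}" "x + y = 0" using card_line[OF u(2)] by auto
    thus ?thesis by (metis add_eq_0_iff2 hv.span_neg)
  qed
  have fu: "f u = 0"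
    using power_minus_mult[of ?q u] by (simp add: f_def)
  have "hv.independent {u}" using u by simp
  then obtain B where B: "{u} \<subseteq> B" "B \<subseteq> V" "hv.independent B" "V \<subseteq> hv.span B"
    using hv.maximal_independent_subset_extend[of "{u}" V] u by auto
  have finB: "finite B" using B(2) finite_card_fin_dim(1)[OF V] finite_subset by blast
  have spB: "hv.span B = V"
    using B hv.span_minimal[OF B(2)] fin_dim_subspace[OF V] by auto
  define C where "C = B - {u}"
  have BC: "B = insert u C" and uC: "u \<notin> hv.span C" and indC: "hv.independent C"
    using B(1,3) hv.independent_mono[OF B(3), of C] unfolding C_def hv.dependent_def by auto
  have Q: "quotW V (hv.span {u}) = hv.span (f ` C)"
  proof -
    have "quotW V (hv.span {u}) = f ` hv.span B" unfolding quotW_line[OF u(2)] spB f_def ..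
    also have "\<dots> = hv.span (f ` B)" using hvp.linear_span_image[OF lin] by simp
    also have "\<dots> = hv.span (f ` C)" unfolding BC using fu by simp
    finally show ?thesis .
  qed
  thus "fin_dim (quotW V (hv.span {u}))"
    unfolding fin_dim_def using finB by (intro exI[of _ "f ` C"]) (auto simp: C_def)
  have inj: "inj_on f (hv.span C)"
    unfolding hvp.linear_inj_on_iff_eq_0[OF lin hv.subspace_span]
  proof (intro ballI impI, rule ccontr)
    fix x assume x: "x \<in> hv.span C" "f x = 0" "x \<noteq> 0"
    obtain c where c: "x = smul c u" using ker[OF x(2)] by (auto simp: hv.span_singleton)
    hence "c \<noteq> 0" using x by auto
    hence "u = smul (inverse c) x" using c by simp
    thus False using uC x(1) hv.span_scale by metis
  qed
  have "hv.independent (f ` C)"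
    by (rule hvp.linear_independent_injective_image[OF lin indC inj])
  hence "fdim (quotW V (hv.span {u})) = card (f ` C)"
    unfolding Q by (rule hv.dim_span_eq_card_independent)
  also have "\<dots> = card C" using inj hv.span_superset[of C] by (intro card_image) (rule inj_on_subset)
  finally have "fdim (quotW V (hv.span {u})) = card C" .
  moreover have "fdim V = card B" using hv.dim_span_eq_card_independent[OF B(3)] spB by simp
  moreover have "u \<notin> C" by (simp add: C_def)
  hence "card B = Suc (card C)" using finB unfolding BC by simp
  ultimately show "Suc (fdim (quotW V (hv.span {u}))) = fdim V" by simp
qed

subsection \<open>Quotients by lines\<close>

text \<open>Up to sign, \<open>u ^ (q - 1)\<close> is the linear coefficient of f_L for the line L
  through u. The expression also makes sense at u = 0, where the final sum is evaluated.\<close>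

definition twist :: "int \<Rightarrow> ('k::{field,finite}) hpoly \<Rightarrow> 'k hpoly" where
  "twist a u = frob a (u ^ (CARD('k) - 1))"

lemma twist_of_nat: "twist (int n) (u::('k::{field,finite}) hpoly) = (u ^ (CARD('k) - 1)) ^ (CARD('k) ^ n)"
  by (simp add: twist_def frob_of_nat)

lemma twist_0 [simp]: "twist a (0::('k::{field,finite}) hpoly) = 0"
  using card_field_ge_2[where 'k='k] by (simp add: twist_def zero_power)

lemma frob_twist: "frob a (twist b u) = twist (a + b) (u::('k::{field,finite}) hpoly)"
  by (simp add: twist_def frob_frob)

text \<open>Substitutes f_L, with x for u^(q-1), into a q-polynomial. Both quotient recursions
  follow by comparing coefficients.\<close>

lemma qfun_compose:
  fixes w x :: "('k::{field,finite}) hpoly"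
  shows "(\<Sum>j<n. b j * (w ^ CARD('k) - x * w) ^ (CARD('k) ^ j)) =
    (\<Sum>j<Suc n. ((case j of 0 \<Rightarrow> 0 | Suc i \<Rightarrow> b i) - (if j < n then b j * x ^ (CARD('k) ^ j) else 0))
       * w ^ (CARD('k) ^ j))"
proof -
  let ?q = "CARD('k)"
  have "(w ^ ?q - x * w) ^ (?q ^ j) = w ^ (?q ^ Suc j) - x ^ (?q ^ j) * w ^ (?q ^ j)" for j
    by (simp add: hpoly_power_card_power_diff power_mult_distrib power_mult)
  hence "(\<Sum>j<n. b j * (w ^ ?q - x * w) ^ (?q ^ j)) =
      (\<Sum>j<n. b j * w ^ (?q ^ Suc j)) - (\<Sum>j<n. b j * x ^ (?q ^ j) * w ^ (?q ^ j))"
    by (simp only: right_diff_distrib sum_subtractf mult.assoc)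
  also have "(\<Sum>j<n. b j * w ^ (?q ^ Suc j)) =
      (\<Sum>j<Suc n. (case j of 0 \<Rightarrow> 0 | Suc i \<Rightarrow> b i) * w ^ (?q ^ j))"
    by (subst sum.lessThan_Suc_shift) simp
  also have "(\<Sum>j<n. b j * x ^ (?q ^ j) * w ^ (?q ^ j)) =
      (\<Sum>j<Suc n. (if j < n then b j * x ^ (?q ^ j) else 0) * w ^ (?q ^ j))"
    by simp
  finally show ?thesis by (simp only: left_diff_distrib sum_subtractf)
qed

text \<open>Let v = w^q - x w with x = u^(q-1), n = dim V/L and r = s + 1. Expand v^(q^(s+n)) in two
  ways: in powers of w, reduced in V, or reduced in V/L and then substituted. The coefficients at
  the top index n give the recursion.\<close>

lemma Hq_quotW_line:
  fixes V :: "('k::{field,finite}) hpoly set"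
  assumes V: "fin_dim V" and u: "u \<in> V" "u \<noteq> 0"
  shows "Hq (quotW V (hv.span {u})) r =
    Hq V r - twist (int (fdim V) + r - 2) u * Hq V (r - 1)"
proof -
  let ?Q = "quotW V (hv.span {u})"
  let ?q = "CARD('k)"
  note Q = fin_dim_quotW_line[OF V u]
  define n where "n = fdim ?Q"
  have d: "fdim V = Suc n" using Q(2) by (simp add: n_def)
  let ?x = "u ^ (?q - 1)"
  have "r = int (Suc (nat r - 1))" if "r > 0" using that by simp
  then consider "r < 0" | "r = 0" | s where "r = int (Suc s)" by (meson linorder_cases)
  thus ?thesis
  proof cases
    case 1
    thus ?thesis by (simp add: Hq_def)
  next
    case 2
    have "Hq V (- 1) = 0" by (simp add: Hq_def)
    thus ?thesis using 2 V Q(1) by simp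
  next
    case (3 s)
    obtain c where c: "\<And>w. w \<in> V \<Longrightarrow> w ^ (?q ^ (Suc s + n)) = (\<Sum>j<Suc n. c j * w ^ (?q ^ j))"
      using qfun_reduce_exists[OF V, of "Suc s + n"] unfolding d by blast
    obtain c' where c': "\<And>w. w \<in> V \<Longrightarrow> w ^ (?q ^ (s + n)) = (\<Sum>j<Suc n. c' j * w ^ (?q ^ j))"
      using qfun_reduce_exists[OF V, of "s + n"] unfolding d by blast
    obtain b where b: "\<And>v. v \<in> ?Q \<Longrightarrow> v ^ (?q ^ (s + n)) = (\<Sum>j<n. b j * v ^ (?q ^ j))"
      using qfun_reduce_exists[OF Q(1), of "s + n"] unfolding n_def by blast
    have "Hq V (int (Suc s)) = c n"
      using Hq_eqI[OF V, of "Suc s" c] c d by simp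
    moreover have "Hq V (int s) = c' n"
      using Hq_eqI[OF V, of s c'] c' d by simp
    \<comment> \<open>If n = 0, the quotient is the zero space and its H vanishes in positive
      degree, which fits the absent coefficient below index 0.\<close>
    moreover have "Hq ?Q (int (Suc s)) = (case n of 0 \<Rightarrow> 0 | Suc i \<Rightarrow> b i)"
    proof (cases n)
      case 0
      thus ?thesis by (simp add: Hq_def n_def)
    next
      case (Suc i)
      thus ?thesis using Hq_eqI[OF Q(1), of "Suc s" b] b by (simp flip: n_def)
    qed
    \<comment> \<open>The false condition \<open>n < n\<close> is kept so that the right side has
      the shape of \<open>qfun_compose\<close> at index n.\<close>
    moreover have "c n - ?x ^ (?q ^ (s + n)) * c' n =
      (case n of 0 \<Rightarrow> 0 | Suc i \<Rightarrow> b i) - (if n < n then b n * ?x ^ (?q ^ n) else 0)"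
    proof (rule qfun_coeff_unique[OF V, unfolded d, where i = n and
          c = "\<lambda>j. c j - ?x ^ (?q ^ (s + n)) * c' j" and
          c' = "\<lambda>j. (case j of 0 \<Rightarrow> 0 | Suc i \<Rightarrow> b i) - (if j < n then b j * ?x ^ (?q ^ j) else 0)"])
      fix w assume w: "w \<in> V"
      let ?v = "w ^ ?q - ?x * w"
      have "(\<Sum>j<Suc n. (c j - ?x ^ (?q ^ (s + n)) * c' j) * w ^ (?q ^ j)) =
          (\<Sum>j<Suc n. c j * w ^ (?q ^ j)) - ?x ^ (?q ^ (s + n)) * (\<Sum>j<Suc n. c' j * w ^ (?q ^ j))"
        by (simp only: left_diff_distrib sum_subtractf sum_distrib_left mult.assoc)
      also have "\<dots> = w ^ (?q ^ (Suc s + n)) - ?x ^ (?q ^ (s + n)) * w ^ (?q ^ (s + n))"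
        using c[OF w] c'[OF w] by simp
      also have "\<dots> = ?v ^ (?q ^ (s + n))"
        by (simp add: hpoly_power_card_power_diff power_mult_distrib power_mult)
      also have "\<dots> = (\<Sum>j<n. b j * ?v ^ (?q ^ j))"
        by (rule b) (use w u quotW_line in blast)
      finally show "(\<Sum>j<Suc n. (c j - ?x ^ (?q ^ (s + n)) * c' j) * w ^ (?q ^ j)) =
        (\<Sum>j<Suc n. ((case j of 0 \<Rightarrow> 0 | Suc i \<Rightarrow> b i) - (if j < n then b j * ?x ^ (?q ^ j) else 0))
          * w ^ (?q ^ j))" unfolding qfun_compose .
    qed simp
    moreover have "twist (int (fdim V) + r - 2) u = ?x ^ (?q ^ (s + n))"
      using twist_of_nat[of "s + n" u] unfolding 3 d by (simp add: add.commute)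
    ultimately show ?thesis unfolding 3 by simp
  qed
qed

text \<open>The sign is given by parity, since the index may be a negative integer.\<close>

definition signed_Eq :: "('k::{field,finite}) hpoly set \<Rightarrow> int \<Rightarrow> 'k hpoly" where
  "signed_Eq W r = (if even r then 1 else -1) * Eq W r"

lemma signed_Eq_nat: "signed_Eq W (int r) = (-1) ^ r * Eq W (int r)"
  by (simp add: signed_Eq_def)

lemma signed_Eq_eq_0: "r < 0 \<or> int (fdim W) < r \<Longrightarrow> signed_Eq W r = 0"
  by (auto simp: signed_Eq_def Eq_def)

text \<open>The monic q-polynomial of V is that of V/L composed with f_L, and its coefficient at
  index dim - r is the signed E_r. Outside 0 <= r <= dim V all terms vanish.\<close>

lemma signed_Eq_quotW_line:
  fixes V :: "('k::{field,finite}) hpoly set"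
  assumes V: "fin_dim V" and u: "u \<in> V" "u \<noteq> 0"
  shows "signed_Eq V r = signed_Eq (quotW V (hv.span {u})) r
    - signed_Eq (quotW V (hv.span {u})) (r - 1) * twist (int (fdim V) - r) u"
proof -
  let ?Q = "quotW V (hv.span {u})"
  let ?q = "CARD('k)"
  note Q = fin_dim_quotW_line[OF V u]
  define n where "n = fdim ?Q"
  have d: "fdim V = Suc n" using Q(2) by (simp add: n_def)
  let ?x = "u ^ (?q - 1)"
  obtain c where c: "\<And>w. w \<in> V \<Longrightarrow> w ^ (?q ^ Suc n) = (\<Sum>j<Suc n. c j * w ^ (?q ^ j))"
    using qfun_reduce_exists[OF V, of "Suc n"] unfolding d by blast
  obtain b where b: "\<And>v. v \<in> ?Q \<Longrightarrow> v ^ (?q ^ n) = (\<Sum>j<n. b j * v ^ (?q ^ j))"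
    using qfun_reduce_exists[OF Q(1), of n] unfolding n_def by blast
  have E0: "signed_Eq V 0 = 1" "signed_Eq ?Q 0 = 1"
    using Eq_eqI(1)[OF V, of c] c Eq_eqI(1)[OF Q(1), of b] b d
    by (simp_all add: signed_Eq_def flip: n_def)
  have "r = int (Suc (nat r - 1)) \<and> nat r - 1 \<le> n" if "r > 0" "r \<le> int (Suc n)" using that by simp
  then consider "r \<le> 0" | "int (Suc n) < r" | s where "r = int (Suc s)" "s \<le> n"
    by (meson not_le)
  thus ?thesis
  proof cases
    case 1
    thus ?thesis using E0 by (cases "r = 0") (auto simp: signed_Eq_eq_0)
  next
    case 2
    thus ?thesis using d by (simp add: signed_Eq_eq_0 flip: n_def)
  next
    case (3 s)
    \<comment> \<open>Coefficients of minus the monic q-polynomial of V/L: the reduction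
      \<open>b\<close> of the top power, and -1 at index n.\<close>
    define b' where "b' j = (if j = n then - 1 else b j)" for j
    have EV: "signed_Eq V (int (Suc s)) = - c (n - s)"
      using Eq_eqI(2)[OF V, of c "Suc s"] c d 3(2) by (simp only: signed_Eq_nat) simp
    have EQ: "signed_Eq ?Q (int t) = - b' (n - t)" if "t \<le> n" for t
    proof (cases "t = 0")
      case True
      thus ?thesis using E0 by (simp add: b'_def)
    next
      case False
      have "signed_Eq ?Q (int t) = - b (n - t)"
        using Eq_eqI(2)[OF Q(1), of b t] b False that by (simp add: signed_Eq_nat flip: n_def)
      moreover have "n - t \<noteq> n" using False that by simp
      ultimately show ?thesis by (simp add: b'_def)
    qed
    have EQ': "signed_Eq ?Q (int (Suc s)) = - (case n - s of 0 \<Rightarrow> 0 | Suc i \<Rightarrow> b' i)"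
    proof (cases "s = n")
      case True
      thus ?thesis using signed_Eq_eq_0[of "int (Suc s)" ?Q] by (simp flip: n_def)
    next
      case False
      hence "Suc s \<le> n" "n - s = Suc (n - Suc s)" using 3(2) by auto
      thus ?thesis using EQ[of "Suc s"] by simp
    qed
    have "c (n - s) = (case n - s of 0 \<Rightarrow> 0 | Suc i \<Rightarrow> b' i) - b' (n - s) * ?x ^ (?q ^ (n - s))"
    proof (rule qfun_coeff_unique[OF V, unfolded d, where i = "n - s" and c = c and
          c' = "\<lambda>j. (case j of 0 \<Rightarrow> 0 | Suc i \<Rightarrow> b' i) - b' j * ?x ^ (?q ^ j)"])
      fix w assume w: "w \<in> V"
      let ?v = "w ^ ?q - ?x * w"
      have "?v ^ (?q ^ n) = (\<Sum>j<n. b j * ?v ^ (?q ^ j))"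
        by (rule b) (use w u quotW_line in blast)
      hence "0 = (\<Sum>j<n. b' j * ?v ^ (?q ^ j)) + b' n * ?v ^ (?q ^ n)"
        by (simp add: b'_def)
      also have "\<dots> = (\<Sum>j<Suc n. b' j * ?v ^ (?q ^ j))" by simp
      also have "\<dots> = (\<Sum>j<Suc (Suc n). ((case j of 0 \<Rightarrow> 0 | Suc i \<Rightarrow> b' i) -
          (if j < Suc n then b' j * ?x ^ (?q ^ j) else 0)) * w ^ (?q ^ j))"
        by (rule qfun_compose)
      also have "\<dots> = (\<Sum>j<Suc n. ((case j of 0 \<Rightarrow> 0 | Suc i \<Rightarrow> b' i) -
          (if j < Suc n then b' j * ?x ^ (?q ^ j) else 0)) * w ^ (?q ^ j)) - w ^ (?q ^ Suc n)"
        by (simp add: b'_def)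
      also have "(\<Sum>j<Suc n. ((case j of 0 \<Rightarrow> 0 | Suc i \<Rightarrow> b' i) -
          (if j < Suc n then b' j * ?x ^ (?q ^ j) else 0)) * w ^ (?q ^ j)) =
          (\<Sum>j<Suc n. ((case j of 0 \<Rightarrow> 0 | Suc i \<Rightarrow> b' i) - b' j * ?x ^ (?q ^ j)) * w ^ (?q ^ j))"
        by (rule sum.cong) auto
      finally show "(\<Sum>j<Suc n. c j * w ^ (?q ^ j)) =
          (\<Sum>j<Suc n. ((case j of 0 \<Rightarrow> 0 | Suc i \<Rightarrow> b' i) - b' j * ?x ^ (?q ^ j)) * w ^ (?q ^ j))"
        unfolding c[OF w, symmetric] by simp
    qed simp
    moreover have "twist (int (fdim V) - r) u = ?x ^ (?q ^ (n - s))"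
      using twist_of_nat[of "n - s" u] 3 d by (simp add: of_nat_diff)
    moreover have "signed_Eq ?Q (r - 1) = - b' (n - s)" using EQ[OF 3(2)] 3 by simp
    ultimately show ?thesis using EV EQ' 3(1) by simp
  qed
qed

subsection \<open>Sums over lines\<close>

text \<open>The argument of Chevalley and Warning. Split off b and expand the product: the set X of
  factors evaluated at multiples of b contributes the power sum of exponent \<open>card X\<close>,
  zero below q - 1. Otherwise few enough factors remain for the induction hypothesis.\<close>

lemma sum_span_prod_linear_eq_0:
  fixes B :: "('k::{field,finite}) hpoly set"
  assumes "finite B" "hv.independent B" "finite A" "card A < card B * (CARD('k) - 1)"
    and "\<And>i. i \<in> A \<Longrightarrow> Vector_Spaces.linear smul smul (g i)"
  shows "(\<Sum>u\<in>hv.span B. \<Prod>i\<in>A. g i u :: 'k hpoly) = 0"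
  using assms
proof (induction B arbitrary: A rule: finite_induct)
  case (insert b B)
  have indep: "hv.independent B" "b \<notin> hv.span B"
    using insert.prems(1) insert.hyps(2) hv.independent_insert[of b B] by auto
  let ?S = "hv.span B"
  have g: "g i (smul c b + x) = smul c (g i b) + g i x" if "i \<in> A" for i c x
    using insert.prems(4)[OF that] by (simp add: linear_smul_iff)
  have smul_prod: "(\<Prod>i\<in>X. smul c (g i b)) = smul (c ^ card X) (\<Prod>i\<in>X. g i b)" for X c
    by (simp add: smul_def prod.distrib single_power)
  have "(\<Sum>u\<in>hv.span (insert b B). \<Prod>i\<in>A. g i u) =
      (\<Sum>(c, x)\<in>UNIV \<times> ?S. \<Prod>i\<in>A. g i (smul c b + x))"
    by (subst sum.reindex_bij_betw[OF bij_betw_span_insert[OF indep(2)], symmetric])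
      (simp add: case_prod_unfold)
  also have "\<dots> = (\<Sum>c\<in>UNIV. \<Sum>x\<in>?S. \<Prod>i\<in>A. smul c (g i b) + g i x)"
    by (subst sum.cartesian_product[symmetric]) (intro sum.cong refl prod.cong g)
  also have "\<dots> = (\<Sum>c\<in>UNIV. \<Sum>x\<in>?S. \<Sum>X\<in>Pow A.
      smul (c ^ card X) (\<Prod>i\<in>X. g i b) * (\<Prod>i\<in>A - X. g i x))"
    unfolding prod_add[OF insert.prems(2)] smul_prod ..
  also have "\<dots> = (\<Sum>c\<in>UNIV. \<Sum>X\<in>Pow A. \<Sum>x\<in>?S.
      smul (c ^ card X) (\<Prod>i\<in>X. g i b) * (\<Prod>i\<in>A - X. g i x))"
    by (intro sum.cong refl, rule sum.swap)
  also have "\<dots> = (\<Sum>X\<in>Pow A. \<Sum>c\<in>UNIV. \<Sum>x\<in>?S.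
      smul (c ^ card X) (\<Prod>i\<in>X. g i b) * (\<Prod>i\<in>A - X. g i x))"
    by (rule sum.swap)
  also have "\<dots> = (\<Sum>X\<in>Pow A. smul (\<Sum>c\<in>UNIV. c ^ card X) (\<Prod>i\<in>X. g i b) *
      (\<Sum>x\<in>?S. \<Prod>i\<in>A - X. g i x))"
    by (simp add: hv.scale_sum_left sum_product)
  also have "\<dots> = 0"
  proof (rule sum.neutral, rule ballI)
    fix X assume X: "X \<in> Pow A"
    show "smul (\<Sum>c\<in>UNIV. c ^ card X) (\<Prod>i\<in>X. g i b) * (\<Sum>x\<in>?S. \<Prod>i\<in>A - X. g i x) = 0"
    proof (cases "card X < CARD('k) - 1")
      case True
      thus ?thesis by (simp add: finite_field_sum_power)
    next
      case False
      have "card (A - X) = card A - card X"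
        using X insert.prems(2) by (intro card_Diff_subset) (auto intro: finite_subset)
      moreover have "card A < card B * (CARD('k) - 1) + (CARD('k) - 1)"
        using insert.prems(3) insert.hyps by (simp add: add.commute)
      ultimately have "card (A - X) < card B * (CARD('k) - 1) \<or> card A - card X < card B * (CARD('k) - 1)"
        using False card_mono[OF insert.prems(2), of X] X by auto
      hence "card (A - X) < card B * (CARD('k) - 1)"
        using \<open>card (A - X) = card A - card X\<close> by auto
      hence "(\<Sum>x\<in>?S. \<Prod>i\<in>A - X. g i x) = 0"
        by (intro insert.IH) (use indep insert.prems in auto)
      thus ?thesis by simp
    qed
  qed
  finally show ?case .
qed simp

text \<open>Each twist is a product of q - 1 equal linear maps \<open>frob (\<alpha> i)\<close>, so
  there are \<open>card I * (q - 1)\<close> linear factors.\<close>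

lemma sum_prod_twist_eq_0:
  fixes U :: "('k::{field,finite}) hpoly set"
  assumes U: "fin_dim U" and I: "finite I" "card I < fdim U"
  shows "(\<Sum>u\<in>U. \<Prod>i\<in>I. twist (\<alpha> i) u) = 0"
proof -
  let ?q = "CARD('k)"
  note fb = fin_dim_fbasis[OF U]
  have "(\<Sum>u\<in>hv.span (set (fbasis U)). \<Prod>i\<in>I \<times> {..<?q - 1}. frob (\<alpha> (fst i)) u) = 0"
  proof (rule sum_span_prod_linear_eq_0)
    have "card (I \<times> {..<?q - 1}) = card I * (?q - 1)" by (simp add: card_cartesian_product)
    also have "\<dots> < card (set (fbasis U)) * (?q - 1)"
      using I card_field_ge_2[where 'k='k] fb by (simp add: distinct_card)
    finally show "card (I \<times> {..<?q - 1}) < card (set (fbasis U)) * (?q - 1)" .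
  qed (use I fb in \<open>auto simp: linear_smul_iff frob_add frob_smul\<close>)
  moreover have "(\<Prod>i\<in>I \<times> {..<?q - 1}. frob (\<alpha> (fst i)) u) = (\<Prod>i\<in>I. twist (\<alpha> i) u)" for u :: "'k hpoly"
  proof -
    have "(\<Prod>i\<in>I \<times> {..<?q - 1}. frob (\<alpha> (fst i)) u) = (\<Prod>i\<in>I. \<Prod>l<?q - 1. frob (\<alpha> i) u)"
      by (simp only: prod.cartesian_product case_prod_unfold)
    thus ?thesis by (simp add: twist_def frob_power)
  qed
  ultimately show ?thesis using fb(3) by simp
qed

abbreviation lines :: "('k::{field,finite}) hpoly set \<Rightarrow> 'k hpoly set set" where
  "lines U \<equiv> {L. fsubspace L \<and> L \<subseteq> U \<and> fdim L = 1}"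

lemma line_eq_span:
  fixes L :: "('k::{field,finite}) hpoly set"
  assumes L: "hv.subspace L" "fdim L = 1" and x: "x \<in> L" "x \<noteq> 0"
  shows "hv.span {x} = L"
proof -
  obtain B where B: "B \<subseteq> L" "hv.independent B" "L \<subseteq> hv.span B" "card B = fdim L"
    using hv.basis_exists[of L] by metis
  then obtain v where v: "B = {v}" using L(2) card_1_singletonE by metis
  obtain c where c: "x = smul c v" using B(3) v x(1) by (auto simp: hv.span_singleton)
  hence "c \<noteq> 0" using x by auto
  hence "v = smul (inverse c) x" using c by simp
  hence "v \<in> hv.span {x}" using hv.span_scale[OF hv.span_base[of x "{x}"]] by simp
  hence "hv.span {v} \<subseteq> hv.span {x}" by (intro hv.span_minimal) auto
  moreover have "hv.span {x} \<subseteq> L" using L x by (intro hv.span_minimal) auto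
  ultimately show ?thesis using B v by auto
qed

lemma span_in_lines:
  fixes U :: "('k::{field,finite}) hpoly set"
  assumes "hv.subspace U" "u \<in> U" "u \<noteq> 0"
  shows "hv.span {u} \<in> lines U"
proof -
  have "hv.span {u} \<subseteq> U" using assms by (intro hv.span_minimal) auto
  moreover have "fdim (hv.span {u}) = 1"
    using hv.dim_span_eq_card_independent[of "{u}"] assms by simp
  ultimately show ?thesis by simp
qed

text \<open>Every nonzero vector of a line spans it, there are q - 1 of them, and q - 1 = -1 in the
  ring.\<close>

lemma sum_nonzero_eq_sum_lines:
  fixes U :: "('k::{field,finite}) hpoly set" and G :: "'k hpoly set \<Rightarrow> 'k hpoly"
  assumes U: "fin_dim U"
  shows "(\<Sum>u\<in>U - {0}. G (hv.span {u})) = - (\<Sum>L\<in>lines U. G L)"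
proof -
  let ?q = "CARD('k)"
  have fin: "finite U" using finite_card_fin_dim[OF U] by simp
  have sub: "hv.subspace U" using U by (rule fin_dim_subspace)
  have finL: "finite (lines U)" by (rule finite_subset[of _ "Pow U"]) (use fin in auto)
  have fib: "{u \<in> U - {0}. hv.span {u} = L} = L - {0}" if "L \<in> lines U" for L
    using that line_eq_span[of L] hv.span_base by blast
  have card: "of_nat (card (L - {0})) = (- 1 :: 'k hpoly)" if L: "L \<in> lines U" for L
  proof -
    obtain x where x: "x \<in> L" "x \<noteq> 0"
    proof -
      have "\<not> L \<subseteq> {0}" using L hv.dim_le_card[of L "{}"] by auto
      thus thesis using that by auto
    qed
    have "hv.span {x} = L" by (rule line_eq_span) (use L x in auto)
    hence "card L = ?q" "finite L" using card_line[OF x(2)] by auto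
    moreover have "0 \<in> L" using L hv.subspace_0 by auto
    ultimately have "Suc (card (L - {0})) = ?q"
      by (metis card_Suc_Diff1)
    moreover have "of_nat ?q = (0 :: 'k hpoly)" unfolding of_nat_hpoly by simp
    ultimately have "1 + of_nat (card (L - {0})) = (0 :: 'k hpoly)" by (metis of_nat_Suc)
    thus ?thesis by (simp add: eq_neg_iff_add_eq_0 add.commute)
  qed
  have "(\<Sum>u\<in>U - {0}. G (hv.span {u})) =
      (\<Sum>L\<in>lines U. \<Sum>u\<in>{u \<in> U - {0}. hv.span {u} = L}. G (hv.span {u}))"
    by (rule sum.group[symmetric]) (use fin finL span_in_lines[OF sub] in auto)
  also have "\<dots> = (\<Sum>L\<in>lines U. \<Sum>u\<in>{u \<in> U - {0}. hv.span {u} = L}. G L)"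
    by (intro sum.cong) auto
  also have "\<dots> = (\<Sum>L\<in>lines U. of_nat (card (L - {0})) * G L)"
    by (rule sum.cong) (simp_all only: fib sum_constant)
  also have "\<dots> = (\<Sum>L\<in>lines U. - G L)"
    by (rule sum.cong) (simp_all only: card mult_minus_left mult_1_left)
  finally show ?thesis by (simp add: sum_negf)
qed

text \<open>\<open>D\<close> extends the summand to u = 0, where there is no line. Its sum over U
  vanishes term by term, so \<open>D 0\<close> cancels the sum over nonzero vectors, which is minus
  the sum over lines.\<close>

lemma sum_lines_expansion:
  fixes U :: "('k::{field,finite}) hpoly set" and G :: "'k hpoly set \<Rightarrow> 'k hpoly"
  assumes U: "fin_dim U"
    and G: "\<And>u. u \<in> U \<Longrightarrow> u \<noteq> 0 \<Longrightarrow> G (hv.span {u}) = D u"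
    and D: "\<And>u. D u = (\<Sum>f\<in>F. C f * (\<Prod>i\<in>I f. twist (\<alpha> i) u))"
    and small: "\<And>f. f \<in> F \<Longrightarrow> C f \<noteq> 0 \<Longrightarrow> finite (I f) \<and> card (I f) < fdim U"
  shows "(\<Sum>L\<in>lines U. G L) = D 0"
proof -
  have fin: "finite U" using finite_card_fin_dim[OF U] by simp
  have "(\<Sum>u\<in>U. D u) = (\<Sum>f\<in>F. C f * (\<Sum>u\<in>U. \<Prod>i\<in>I f. twist (\<alpha> i) u))"
    unfolding D by (subst sum.swap) (simp add: sum_distrib_left)
  also have "\<dots> = 0"
  proof (rule sum.neutral, rule ballI)
    fix f assume f: "f \<in> F"
    show "C f * (\<Sum>u\<in>U. \<Prod>i\<in>I f. twist (\<alpha> i) u) = 0"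
    proof (cases "C f = 0")
      case False
      thus ?thesis using small[OF f] sum_prod_twist_eq_0[OF U, of "I f"] by simp
    qed simp
  qed
  finally have "D 0 + (\<Sum>u\<in>U - {0}. D u) = 0"
    using fin hv.subspace_0[OF fin_dim_subspace[OF U]] by (simp add: sum.remove)
  moreover have "(\<Sum>u\<in>U - {0}. D u) = - (\<Sum>L\<in>lines U. G L)"
    unfolding sum_nonzero_eq_sum_lines[OF U, symmetric] by (rule sum.cong) (use G in auto)
  ultimately show ?thesis by simp
qed

section \<open>Expansion of determinants by rows and the resulting count of twists\<close>

text \<open>Multilinearity in the rows: f picks a summand in each row, and its weight can be pulled
  out because it does not depend on the column.\<close>

lemma det_sum_expansion:
  fixes A :: "nat \<Rightarrow> 'b \<Rightarrow> nat \<Rightarrow> 'a::comm_ring_1"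
  assumes "finite T"
  shows "det (mat N N (\<lambda>(i, j). \<Sum>t\<in>T. g i t * A i t j)) =
    (\<Sum>f\<in>PiE {0..<N} (\<lambda>_. T). (\<Prod>i=0..<N. g i (f i)) * det (mat N N (\<lambda>(i, j). A i (f i) j)))"
proof -
  let ?P = "{p. p permutes {0..<N}}"
  have p: "p i < N" if "p \<in> ?P" "i \<in> {0..<N}" for p i
    using that permutes_in_image[of p "{0..<N}" i] by auto
  have "det (mat N N (\<lambda>(i, j). \<Sum>t\<in>T. g i t * A i t j)) =
      (\<Sum>p\<in>?P. signof p * (\<Prod>i=0..<N. \<Sum>t\<in>T. g i t * A i t (p i)))"
    by (subst det_def'[of _ N]) (use p in \<open>auto intro!: sum.cong prod.cong arg_cong2[of _ _ _ _ "(*)"]\<close>)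
  also have "\<dots> = (\<Sum>p\<in>?P. \<Sum>f\<in>PiE {0..<N} (\<lambda>_. T).
      (\<Prod>i=0..<N. g i (f i)) * (signof p * (\<Prod>i=0..<N. A i (f i) (p i))))"
    by (subst prod_sum_PiE) (use assms in \<open>auto simp: prod.distrib sum_distrib_left mult_ac\<close>)
  also have "\<dots> = (\<Sum>f\<in>PiE {0..<N} (\<lambda>_. T).
      (\<Prod>i=0..<N. g i (f i)) * (\<Sum>p\<in>?P. signof p * (\<Prod>i=0..<N. A i (f i) (p i))))"
    by (subst sum.swap) (simp only: sum_distrib_left)
  also have "\<dots> = (\<Sum>f\<in>PiE {0..<N} (\<lambda>_. T).
      (\<Prod>i=0..<N. g i (f i)) * det (mat N N (\<lambda>(i, j). A i (f i) j)))"
    by (subst det_def'[of _ N]) (use p in \<open>auto intro!: sum.cong prod.cong arg_cong2[of _ _ _ _ "(*)"]\<close>)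
  finally show ?thesis .
qed

text \<open>The N - l rows from l on can be nonzero only in the N - l - 1 columns beyond l, so every
  permutation meets a zero entry.\<close>

lemma det_eq_0_block:
  fixes A :: "nat \<Rightarrow> nat \<Rightarrow> 'a::comm_ring_1"
  assumes l: "l < N" and zero: "\<And>i j. l \<le> i \<Longrightarrow> i < N \<Longrightarrow> j \<le> l \<Longrightarrow> A i j = 0"
  shows "det (mat N N (\<lambda>(i, j). A i j)) = 0"
proof -
  have "(\<Prod>i=0..<N. mat N N (\<lambda>(i, j). A i j) $$ (i, p i)) = 0" if p: "p permutes {0..<N}" for p
  proof -
    have "\<exists>i\<in>{l..<N}. p i \<le> l"
    proof (rule ccontr)
      assume "\<not> ?thesis"
      hence "p ` {l..<N} \<subseteq> {Suc l..<N}"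
        using permutes_in_image[OF p] by (auto simp: not_le)
      hence "card (p ` {l..<N}) \<le> card {Suc l..<N}" by (intro card_mono) auto
      moreover have "card (p ` {l..<N}) = card {l..<N}"
        using permutes_inj[OF p] by (intro card_image) (auto intro: inj_on_subset)
      ultimately show False using l by simp
    qed
    then obtain i where i: "l \<le> i" "i < N" "p i \<le> l" by auto
    hence "mat N N (\<lambda>(i, j). A i j) $$ (i, p i) = 0" using l zero by simp
    thus ?thesis using i by (intro prod_zero bexI[of _ i]) auto
  qed
  thus ?thesis by (subst det_def'[of _ N]) (auto intro!: sum.neutral)
qed

text \<open>Choosing summand \<open>f i\<close> in row i costs \<open>f i\<close> twists, so the sum
  of all \<open>f i\<close> has to stay below dim U. As M is common to all rows,
  \<open>\<kappa>\<close> carries the signs and the cut-offs that vary with the row.\<close>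

lemma sum_lines_det:
  fixes U :: "('k::{field,finite}) hpoly set" and G :: "'k hpoly set \<Rightarrow> 'k hpoly"
  assumes U: "fin_dim U"
    and G: "\<And>u. u \<in> U \<Longrightarrow> u \<noteq> 0 \<Longrightarrow> G (hv.span {u}) = D u"
    and D: "\<And>u. D u = det (mat N N (\<lambda>(i, j). \<Sum>t\<le>M. (\<kappa> i t * (\<Prod>s<t. twist (\<alpha> i s) u)) * A i t j))"
    and small: "\<And>f. (\<And>i. i < N \<Longrightarrow> \<kappa> i (f i) \<noteq> 0) \<Longrightarrow>
      det (mat N N (\<lambda>(i, j). A i (f i) j)) \<noteq> 0 \<Longrightarrow> (\<Sum>i<N. f i) < fdim U"
  shows "(\<Sum>L\<in>lines U. G L) = D 0"
proof -
  let ?C = "\<lambda>f. (\<Prod>i=0..<N. \<kappa> i (f i)) * det (mat N N (\<lambda>(i, j). A i (f i) j))"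
  \<comment> \<open>One pair per twist, so that equal twists count with multiplicity.\<close>
  let ?I = "\<lambda>f. Sigma {0..<N} (\<lambda>i. {..<f i})"
  let ?F = "PiE {0..<N} (\<lambda>_. {..M})"
  have expand: "D u = (\<Sum>f\<in>?F. ?C f * (\<Prod>x\<in>?I f. twist (case_prod \<alpha> x) u))" for u
    unfolding D
    by (subst det_sum_expansion)
      (auto simp: prod.distrib prod.Sigma case_prod_unfold mult_ac intro!: sum.cong)
  have card: "finite (?I f) \<and> card (?I f) < fdim U" if "?C f \<noteq> 0" for f
  proof -
    have "\<And>i. i < N \<Longrightarrow> \<kappa> i (f i) \<noteq> 0" "det (mat N N (\<lambda>(i, j). A i (f i) j)) \<noteq> 0"
      using that by (auto simp: prod_zero_iff)
    from small[OF this] show ?thesis by (simp add: atLeast0LessThan)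
  qed
  show ?thesis
  proof (rule sum_lines_expansion[OF U])
    show "\<And>u. u \<in> U \<Longrightarrow> u \<noteq> 0 \<Longrightarrow> G (hv.span {u}) = D u" by (rule G)
    show "\<And>u. D u = (\<Sum>f\<in>?F. ?C f * (\<Prod>x\<in>?I f. twist (case_prod \<alpha> x) u))" by (rule expand)
    show "\<And>f. ?C f \<noteq> 0 \<Longrightarrow> finite (?I f) \<and> card (?I f) < fdim U" by (rule card)
  qed
qed

subsection \<open>The two determinants\<close>

lemma det_mat_transpose:
  "det (mat N N (\<lambda>(i, j). A j i)) = det (mat N N (\<lambda>(i, j). A i j :: 'a::comm_ring_1))"
proof -
  have "mat N N (\<lambda>(i, j). A j i) = transpose_mat (mat N N (\<lambda>(i, j). A i j))"
    by (rule eq_matI) auto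
  thus ?thesis using det_transpose[of "mat N N (\<lambda>(i, j). A i j)" N] by simp
qed

text \<open>Right multiplication by a unit upper bidiagonal matrix; each new column uses the
  original left neighbour.\<close>

lemma det_adjacent_column_operations:
  fixes A B :: "nat \<Rightarrow> nat \<Rightarrow> 'a::comm_ring_1"
  assumes B0: "\<And>i. i < N \<Longrightarrow> 0 < N \<Longrightarrow> B i 0 = A i 0"
    and BS: "\<And>i j. i < N \<Longrightarrow> Suc j < N \<Longrightarrow> B i (Suc j) = A i (Suc j) - y (Suc j) * A i j"
  shows "det (mat N N (\<lambda>(i, j). B i j)) = det (mat N N (\<lambda>(i, j). A i j))"
proof -
  let ?A = "mat N N (\<lambda>(i, j). A i j)"
  let ?C = "mat N N (\<lambda>(l, j). (if l = j then 1 else 0) + (if Suc l = j then - y j else 0))"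
  have "mat N N (\<lambda>(i, j). B i j) = ?A * ?C"
  proof (rule eq_matI)
    fix i j assume "i < dim_row (?A * ?C)" "j < dim_col (?A * ?C)"
    hence ij: "i < N" "j < N" by auto
    have "(?A * ?C) $$ (i, j) =
        (\<Sum>l<N. A i l * ((if l = j then 1 else 0) + (if Suc l = j then - y j else 0)))"
      using ij by (simp add: scalar_prod_def atLeast0LessThan)
    also have "\<dots> = (\<Sum>l<N. if l = j then A i l else 0) + (\<Sum>l<N. if Suc l = j then - (y j * A i l) else 0)"
      unfolding sum.distrib[symmetric] by (rule sum.cong) (auto simp: algebra_simps)
    also have "(\<Sum>l<N. if l = j then A i l else 0) = A i j" using ij by simp
    also have "A i j + (\<Sum>l<N. if Suc l = j then - (y j * A i l) else 0) = B i j"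
    proof (cases j)
      case 0
      thus ?thesis using B0[of i] ij by simp
    next
      case (Suc j')
      thus ?thesis using BS[of i j'] ij by simp
    qed
    finally show "mat N N (\<lambda>(i, j). B i j) $$ (i, j) = (?A * ?C) $$ (i, j)" using ij by simp
  qed auto
  moreover have "det ?C = 1"
  proof -
    have "det ?C = (\<Prod>l = 0..<N. ?C $$ (l, l))"
      by (subst det_upper_triangular[of _ N]) (auto simp: prod_list_diag_prod)
    also have "\<dots> = 1" by (rule prod.neutral) auto
    finally show ?thesis .
  qed
  ultimately show ?thesis using det_mult[of ?A N ?C] by simp
qed

text \<open>Each row for V/L is the row for V minus one twist times a modified row. A choice that
  modifies a row with \<open>a i = b i\<close> gives a zero block, so at most one twist occurs for
  each row with \<open>a i \<noteq> b i\<close>.\<close>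

lemma sum_lines_det_Hq:
  fixes U V :: "('k::{field,finite}) hpoly set" and a b :: "nat \<Rightarrow> int"
  assumes V: "fin_dim V" and U: "fin_dim U" "U \<subseteq> V"
    and a: "\<And>i j. i < j \<Longrightarrow> a j < a i" and b: "\<And>i j. i < j \<Longrightarrow> b j < b i"
    and small: "card {i. i < N \<and> a i \<noteq> b i} < fdim U"
  shows "(\<Sum>L\<in>lines U. det (mat N N (\<lambda>(i, j). frob (b j + 1) (Hq (quotW V L) (a i - b j))))) =
    det (mat N N (\<lambda>(i, j). frob (b j + 1) (Hq V (a i - b j))))"
proof -
  define A where "A i t j = frob (b j + 1) (Hq V (a i - int t - b j))" for i t j
  define \<kappa> where "\<kappa> t = (if t = 0 then 1 else if t = 1 then - 1 else 0 :: 'k hpoly)" for t :: nat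
  \<comment> \<open>Applying \<open>frob (b j + 1)\<close> to the twist in
    \<open>Hq_quotW_line\<close> cancels \<open>b j\<close>, so the exponent depends on the row
    alone.\<close>
  define \<alpha> where "\<alpha> i = int (fdim V) + a i - 1" for i
  define D where "D u = det (mat N N (\<lambda>(i, j). \<Sum>t\<le>1. (\<kappa> t * (\<Prod>s<t. twist (\<alpha> i) u)) * A i t j))" for u
  have entry: "(\<Sum>t\<le>1. (\<kappa> t * (\<Prod>s<t. twist (\<alpha> i) u)) * A i t j) =
      A i 0 j - twist (\<alpha> i) u * A i 1 j" for i j u
    by (simp add: \<kappa>_def)
  have "(\<Sum>L\<in>lines U. det (mat N N (\<lambda>(i, j). frob (b j + 1) (Hq (quotW V L) (a i - b j))))) = D 0"
  proof (rule sum_lines_det[OF U(1) _ D_def])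
    fix u assume u: "u \<in> U" "u \<noteq> 0"
    have "frob (b j + 1) (Hq (quotW V (hv.span {u})) (a i - b j)) = A i 0 j - twist (\<alpha> i) u * A i 1 j" for i j
    proof -
      have "Hq (quotW V (hv.span {u})) (a i - b j) = Hq V (a i - b j)
          - twist (int (fdim V) + (a i - b j) - 2) u * Hq V (a i - b j - 1)"
        by (rule Hq_quotW_line) (use V u U in auto)
      moreover have "b j + 1 + (int (fdim V) + (a i - b j) - 2) = \<alpha> i" by (simp add: \<alpha>_def)
      moreover have "a i - b j - 1 = a i - int 1 - b j" by simp
      ultimately show ?thesis by (simp only: frob_diff frob_mult frob_twist A_def) simp
    qed
    thus "det (mat N N (\<lambda>(i, j). frob (b j + 1) (Hq (quotW V (hv.span {u})) (a i - b j)))) = D u"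
      unfolding D_def entry by simp
  next
    fix f :: "nat \<Rightarrow> nat"
    assume \<kappa>: "\<And>i. i < N \<Longrightarrow> \<kappa> (f i) \<noteq> 0" and nz: "det (mat N N (\<lambda>(i, j). A i (f i) j)) \<noteq> 0"
    have f1: "f i \<le> 1" if "i < N" for i using \<kappa>[OF that] by (auto simp: \<kappa>_def split: if_splits)
    have f0: "f l = 0" if l: "l < N" "a l = b l" for l
    proof (rule ccontr)
      assume "f l \<noteq> 0"
      hence fl: "f l = 1" using f1[OF l(1)] by simp
      \<comment> \<open>The index of H is negative here: in row l it is at most
        \<open>a l - 1 - b l = -1\<close>, and later rows have \<open>a i < a l\<close>.\<close>
      have "A i (f i) j = 0" if ij: "l \<le> i" "i < N" "j \<le> l" for i j
      proof -
        have "b l \<le> b j" using b[of j l] ij by (cases "j = l") auto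
        hence "a i - int (f i) - b j < 0" using a[of l i] fl l ij by (cases "i = l") auto
        thus ?thesis by (simp add: A_def Hq_def)
      qed
      hence "det (mat N N (\<lambda>(i, j). A i (f i) j)) = 0" by (rule det_eq_0_block[OF l(1)])
      with nz show False by simp
    qed
    have "(\<Sum>i<N. f i) \<le> (\<Sum>i<N. if a i \<noteq> b i then 1 else 0)"
      by (rule sum_mono) (use f0 f1 in auto)
    also have "\<dots> = card {i. i < N \<and> a i \<noteq> b i}"
      by (simp flip: sum.inter_filter add: lessThan_def)
    finally show "(\<Sum>i<N. f i) < fdim U" using small by simp
  qed
  also have "D 0 = det (mat N N (\<lambda>(i, j). frob (b j + 1) (Hq V (a i - b j))))"
    unfolding D_def entry by (simp add: A_def)
  finally show ?thesis .
qed

text \<open>Solves the recursion for V/L and iterates it n times. After \<open>frob x\<close> the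
  twist exponents are free of x, so in the determinant they depend on the column only.\<close>

lemma signed_Eq_quotW_line_iterate:
  fixes V :: "('k::{field,finite}) hpoly set"
  assumes V: "fin_dim V" and u: "u \<in> V" "u \<noteq> 0"
  defines "Q \<equiv> quotW V (hv.span {u})"
  shows "frob x (signed_Eq Q (x - y)) =
    (\<Sum>t<n. (\<Prod>s<t. twist (int (fdim V) + y + int s) u) * frob x (signed_Eq V (x - (y + int t))))
    + (\<Prod>s<n. twist (int (fdim V) + y + int s) u) * frob x (signed_Eq Q (x - (y + int n)))"
proof (induction n)
  case (Suc n)
  let ?z = "y + int n"
  have "signed_Eq V (x - ?z) = signed_Eq Q (x - ?z)
      - signed_Eq Q (x - ?z - 1) * twist (int (fdim V) - (x - ?z)) u"
    unfolding Q_def by (rule signed_Eq_quotW_line[OF V u])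
  hence "signed_Eq Q (x - ?z) = signed_Eq V (x - ?z)
      + twist (int (fdim V) - (x - ?z)) u * signed_Eq Q (x - (y + int (Suc n)))"
    by (simp add: mult.commute algebra_simps)
  hence "frob x (signed_Eq Q (x - ?z)) = frob x (signed_Eq V (x - ?z))
      + twist (x + (int (fdim V) - (x - ?z))) u * frob x (signed_Eq Q (x - (y + int (Suc n))))"
    by (simp only: frob_add frob_mult frob_twist)
  moreover have "x + (int (fdim V) - (x - ?z)) = int (fdim V) + y + int n" by simp
  ultimately have "frob x (signed_Eq Q (x - ?z)) = frob x (signed_Eq V (x - ?z))
      + twist (int (fdim V) + y + int n) u * frob x (signed_Eq Q (x - (y + int (Suc n))))"
    by (simp only:)
  thus ?case unfolding Suc.IH by (simp only: sum.lessThan_Suc prod.lessThan_Suc distrib_left mult.assoc add.assoc)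
qed simp

text \<open>Expressing the entries for \<open>V/L\<close> in column \<open>j\<close> through \<open>V\<close> gives a long sum; subtracting a
  multiple of column \<open>j - 1\<close> truncates it at \<open>b (j - 1)\<close>.\<close>

lemma sum_lines_det_Eq:
  fixes U V :: "('k::{field,finite}) hpoly set" and a b :: "nat \<Rightarrow> int"
  assumes V: "fin_dim V" and U: "fin_dim U" "U \<subseteq> V"
    and a: "\<And>i j. i < j \<Longrightarrow> a j < a i" and b: "\<And>i j. i < j \<Longrightarrow> b j < b i"
    and ba: "\<And>i. b i \<le> a i"
    and small: "\<And>f. (\<And>j. j < N \<Longrightarrow> b j + int (f j) \<le> a j) \<Longrightarrow>
      (\<And>j. Suc j < N \<Longrightarrow> b (Suc j) + int (f (Suc j)) < b j) \<Longrightarrow> (\<Sum>j<N. f j) < fdim U"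
  shows "(\<Sum>L\<in>lines U. det (mat N N (\<lambda>(i, j). frob (a i) (signed_Eq (quotW V L) (a i - b j))))) =
    det (mat N N (\<lambda>(i, j). frob (a i) (signed_Eq V (a i - b j))))"
proof -
  \<comment> \<open>Column j keeps the indices from \<open>b j\<close> to just below
    \<open>b (j - 1)\<close>. Column 0 has no left neighbour and runs up to \<open>a 0\<close>,
    beyond which the index of E is negative in every row.\<close>
  define n where "n j = nat (case j of 0 \<Rightarrow> a 0 + 1 - b 0 | Suc j' \<Rightarrow> b j' - b (Suc j'))" for j
  define M where "M = (\<Sum>j<N. n j)"
  have n_pos: "0 < n j" for j
    using ba[of 0] b[of "j - 1" j] by (cases j) (auto simp: n_def)
  have n_0: "b 0 + int (n 0) = a 0 + 1" using ba[of 0] by (simp add: n_def)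
  have n_Suc: "b (Suc j) + int (n (Suc j)) = b j" for j using b[of j "Suc j"] by (simp add: n_def)
  have n_le: "n j \<le> M" if "j < N" for j
    unfolding M_def by (rule member_le_sum) (use that in auto)
  define A where "A j t i = frob (a i) (signed_Eq V (a i - (b j + int t)))" for j t i
  define \<kappa> where "\<kappa> j t = (if t < n j then 1 else 0 :: 'k hpoly)" for j t
  define \<alpha> where "\<alpha> j s = int (fdim V) + b j + int s" for j s
  \<comment> \<open>Transposed, because here the twists depend on the column while
    \<open>sum_lines_det\<close> expands by rows.\<close>
  define D where "D u = det (mat N N (\<lambda>(j, i). \<Sum>t\<le>M. (\<kappa> j t * (\<Prod>s<t. twist (\<alpha> j s) u)) * A j t i))" for u
  have entry: "(\<Sum>t\<le>M. (\<kappa> j t * (\<Prod>s<t. twist (\<alpha> j s) u)) * A j t i) =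
      (\<Sum>t<n j. (\<Prod>s<t. twist (\<alpha> j s) u) * A j t i)" if "j < N" for i j u
    using n_le[OF that] by (intro sum.mono_neutral_cong_right) (auto simp: \<kappa>_def)
  have D_eq: "D u = det (mat N N (\<lambda>(i, j). \<Sum>t<n j. (\<Prod>s<t. twist (\<alpha> j s) u) * A j t i))" for u
  proof -
    have "D u = det (mat N N (\<lambda>(j, i). \<Sum>t<n j. (\<Prod>s<t. twist (\<alpha> j s) u) * A j t i))"
      unfolding D_def by (intro arg_cong[of _ _ det] eq_matI) (auto simp: entry)
    thus ?thesis
      using det_mat_transpose[of N "\<lambda>i j. \<Sum>t<n j. (\<Prod>s<t. twist (\<alpha> j s) u) * A j t i"] by simp
  qed
  have "(\<Sum>L\<in>lines U. det (mat N N (\<lambda>(i, j). frob (a i) (signed_Eq (quotW V L) (a i - b j))))) = D 0"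
  proof (rule sum_lines_det[OF U(1) _ D_def])
    fix u assume u: "u \<in> U" "u \<noteq> 0"
    let ?Q = "quotW V (hv.span {u})"
    let ?e = "\<lambda>i j. frob (a i) (signed_Eq ?Q (a i - b j))"
    have it: "?e i j = (\<Sum>t<n j. (\<Prod>s<t. twist (\<alpha> j s) u) * A j t i)
        + (\<Prod>s<n j. twist (\<alpha> j s) u) * frob (a i) (signed_Eq ?Q (a i - (b j + int (n j))))" for i j
      unfolding A_def \<alpha>_def by (rule signed_Eq_quotW_line_iterate) (use V U u in auto)
    \<comment> \<open>After \<open>n (Suc j)\<close> steps the remainder of column
      \<open>Suc j\<close> starts at \<open>b j\<close>, so it is a multiple of column j for V/L,
      which the column operation removes. In column 0 the remainder is zero.\<close>
    have "det (mat N N (\<lambda>(i, j). \<Sum>t<n j. (\<Prod>s<t. twist (\<alpha> j s) u) * A j t i)) =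
        det (mat N N (\<lambda>(i, j). ?e i j))"
    proof (rule det_adjacent_column_operations[where y = "\<lambda>j. \<Prod>s<n j. twist (\<alpha> j s) u"])
      fix i
      have "a i \<le> a 0" using a[of 0 i] by (cases "i = 0") auto
      hence "signed_Eq ?Q (a i - (b 0 + int (n 0))) = 0"
        unfolding n_0 by (intro signed_Eq_eq_0) auto
      thus "(\<Sum>t<n 0. (\<Prod>s<t. twist (\<alpha> 0 s) u) * A 0 t i) = ?e i 0"
        unfolding it[of i 0] by simp
    next
      fix i j
      show "(\<Sum>t<n (Suc j). (\<Prod>s<t. twist (\<alpha> (Suc j) s) u) * A (Suc j) t i) =
          ?e i (Suc j) - (\<Prod>s<n (Suc j). twist (\<alpha> (Suc j) s) u) * ?e i j"
        using it[of i "Suc j"] unfolding n_Suc by simp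
    qed
    thus "det (mat N N (\<lambda>(i, j). ?e i j)) = D u" unfolding D_eq by simp
  next
    fix f :: "nat \<Rightarrow> nat"
    assume \<kappa>: "\<And>j. j < N \<Longrightarrow> \<kappa> j (f j) \<noteq> 0" and nz: "det (mat N N (\<lambda>(j, i). A j (f j) i)) \<noteq> 0"
    have fn: "f j < n j" if "j < N" for j using \<kappa>[OF that] by (auto simp: \<kappa>_def split: if_splits)
    have gap: "b (Suc j) + int (f (Suc j)) < b j" if "Suc j < N" for j
      using fn[OF that] n_Suc[of j] by linarith
    show "(\<Sum>j<N. f j) < fdim U"
    proof (rule small[OF _ gap])
      fix l assume l: "l < N"
      show "b l + int (f l) \<le> a l"
      proof (rule ccontr)
        assume less: "\<not> ?thesis"
        \<comment> \<open>By the gaps, \<open>b j + int (f j)\<close> is at least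
          \<open>b l + int (f l)\<close>, which exceeds \<open>a l\<close> and hence
          \<open>a i\<close>; the index of E is negative throughout the block.\<close>
        have "A j (f j) i = 0" if ij: "l \<le> i" "i < N" "j \<le> l" for i j
        proof -
          have "b l + int (f l) \<le> b j + int (f j)"
          proof (cases "j = l")
            case False
            then obtain l' where l': "l = Suc l'" "j \<le> l'" using ij by (cases l) auto
            have "b l' \<le> b j" using b[of j l'] l' by (cases "j = l'") auto
            thus ?thesis using gap[of l'] l l' by simp
          qed simp
          moreover have "a i \<le> a l" using a[of l i] ij by (cases "i = l") auto
          ultimately have "a i - (b j + int (f j)) < 0" using less by simp
          thus ?thesis by (simp add: A_def signed_Eq_eq_0)
        qed
        hence "det (mat N N (\<lambda>(i, j). A j (f j) i)) = 0" by (intro det_eq_0_block[OF l]) auto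
        thus False using nz det_mat_transpose[of N "\<lambda>i j. A j (f j) i"] by simp
      qed
    qed
  qed
  also have "D 0 = det (mat N N (\<lambda>(i, j). frob (a i) (signed_Eq V (a i - b j))))"
  proof -
    \<comment> \<open>At u = 0 all twists vanish and only the empty product at t = 0 is left; it
      occurs because \<open>n j\<close> is positive.\<close>
    have "(\<Sum>t<n j. (\<Prod>s<t. twist (\<alpha> j s) 0) * A j t i) = A j 0 i" for i j
    proof -
      have "(\<Sum>t<n j. (\<Prod>s<t. twist (\<alpha> j s) 0) * A j t i) = (\<Sum>t<n j. if t = 0 then A j t i else 0)"
        by (rule sum.cong) (auto simp: zero_power)
      thus ?thesis using n_pos by simp
    qed
    thus ?thesis unfolding D_eq by (simp add: A_def)
  qed
  finally show ?thesis .
qed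

section \<open>Partitions and their conjugates\<close>

lemma part_antimono:
  assumes "is_partition l" "1 \<le> i" "i \<le> j"
  shows "part l j \<le> part l i"
proof (cases "i < j \<and> j \<le> length l")
  case True
  hence "l ! (j - 1) \<le> l ! (i - 1)"
    using assms unfolding is_partition_def sorted_wrt_iff_nth_less by auto
  thus ?thesis using True assms by (simp add: part_def)
qed (use assms in \<open>auto simp: part_def\<close>)

lemma conj_part_eq_card:
  assumes "1 \<le> k"
  shows "conj_part l k = card {i. k \<le> part l (Suc i)}" "finite {i. k \<le> part l (Suc i)}"
proof -
  have eq: "{i. k \<le> part l (Suc i)} = {i. i < length l \<and> k \<le> l ! i}"
    using assms by (auto simp: part_def Suc_le_eq)
  show "conj_part l k = card {i. k \<le> part l (Suc i)}"
    unfolding eq using assms by (simp add: conj_part_def length_filter_conv_card)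
  show "finite {i. k \<le> part l (Suc i)}" unfolding eq by simp
qed

text \<open>The hypotheses give a box of the skew shape in column k. Every row of \<open>mu\<close>
  that reaches column k does so in \<open>lam\<close> too, and the row of the box does so only in
  \<open>lam\<close>.\<close>

lemma conj_part_less:
  assumes sub: "\<And>i. part mu i \<le> part lam i" and k: "part mu (Suc i) < k" "k \<le> part lam (Suc i)"
  shows "conj_part mu k < conj_part lam k"
proof -
  have "1 \<le> k" using k by simp
  moreover have "{i. k \<le> part mu (Suc i)} \<subset> {i. k \<le> part lam (Suc i)}"
  proof
    show "{i. k \<le> part mu (Suc i)} \<subseteq> {i. k \<le> part lam (Suc i)}"
      using sub by (auto intro: le_trans)
    have "i \<in> {i. k \<le> part lam (Suc i)}" "i \<notin> {i. k \<le> part mu (Suc i)}" using k by auto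
    thus "{i. k \<le> part mu (Suc i)} \<noteq> {i. k \<le> part lam (Suc i)}" by blast
  qed
  ultimately show ?thesis
    unfolding conj_part_eq_card(1)[OF \<open>1 \<le> k\<close>]
    by (intro psubset_card_mono conj_part_eq_card(2))
qed

lemma finite_conj_part_less: "finite {j. conj_part mu j < conj_part lam j}"
proof (rule finite_subset)
  show "{j. conj_part mu j < conj_part lam j} \<subseteq> {..sum_list lam}"
  proof
    fix j assume "j \<in> {j. conj_part mu j < conj_part lam j}"
    hence "filter (\<lambda>x. j \<le> x) lam \<noteq> []" by (auto simp: conj_part_def split: if_splits)
    then obtain x where "x \<in> set lam" "j \<le> x" by (auto simp: filter_empty_conv)
    thus "j \<in> {..sum_list lam}" using member_le_sum_list[of x lam] by simp
  qed
qed simp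

theorem mainTheorem6:
  fixes U V :: "('k::{field,finite}) hpoly set" and n :: nat and lam mu :: "nat list"
  assumes "fsubspace V" "V \<subseteq> polyS n" "fin_dim V"
    and "fsubspace U" "U \<subseteq> V" "fin_dim U"
    and "is_partition lam" "is_partition mu" "\<forall>i. part mu i \<le> part lam i"
  shows "(card {i. part mu i < part lam i} < fdim U \<longrightarrow>
            skewS lam mu V = (\<Sum>L\<in>{L. fsubspace L \<and> L \<subseteq> U \<and> fdim L = 1}. skewS lam mu (quotW V L)))
       \<and> (card {j. conj_part mu j < conj_part lam j} < fdim U \<longrightarrow>
            skewT lam mu V = (\<Sum>L\<in>{L. fsubspace L \<and> L \<subseteq> U \<and> fdim L = 1}. skewT lam mu (quotW V L)))"
proof -
  define N where "N = max (length lam) (length mu)"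
  \<comment> \<open>Subtracting the row number makes the parts strictly decreasing. Rows count from
    0 here, whereas \<open>part\<close> counts from 1.\<close>
  define a where "a i = int (part lam (Suc i)) - int (Suc i)" for i
  define b where "b i = int (part mu (Suc i)) - int (Suc i)" for i
  have sub: "\<And>i. part mu i \<le> part lam i" using assms by simp
  have a: "a j < a i" if "i < j" for i j
    using part_antimono[OF assms(7), of "Suc i" "Suc j"] that by (simp add: a_def)
  have mu_anti: "part mu (Suc j) \<le> part mu (Suc i)" if "i \<le> j" for i j
    using part_antimono[OF assms(8)] that by simp
  have b: "b j < b i" if "i < j" for i j
    using mu_anti[of i j] that by (simp add: b_def)
  have ba: "b i \<le> a i" for i using sub by (simp add: a_def b_def)
  have S: "skewS lam mu W = det (mat N N (\<lambda>(i, j). frob (b j + 1) (Hq W (a i - b j))))"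
    for W :: "'k hpoly set"
    unfolding skewS_def Let_def N_def[symmetric]
    by (intro arg_cong[of _ _ det] eq_matI) (auto simp: a_def b_def algebra_simps)
  have T: "skewT lam mu W = det (mat N N (\<lambda>(i, j). frob (a i) (signed_Eq W (a i - b j))))"
    for W :: "'k hpoly set"
  proof -
    have "(if even e then 1 else - 1) * frob x (Eq W e) = frob x (signed_Eq W e)" for e x
      by (simp add: signed_Eq_def frob_uminus)
    moreover have "int (part lam (i + 1)) - int (part mu (j + 1)) - int (i + 1) + int (j + 1) = a i - b j"
      "int (part lam (i + 1)) - int (i + 1) = a i" for i j
      by (simp_all add: a_def b_def)
    ultimately show ?thesis unfolding skewT_def Let_def N_def[symmetric] by (simp only:)
  qed
  show ?thesis
  proof (intro conjI impI)
    assume "card {i. part mu i < part lam i} < fdim U"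
    moreover have "card {i. i < N \<and> a i \<noteq> b i} \<le> card {i. part mu i < part lam i}"
    proof (rule card_inj_on_le[of Suc])
      show "Suc ` {i. i < N \<and> a i \<noteq> b i} \<subseteq> {i. part mu i < part lam i}"
        using sub by (auto simp: a_def b_def le_neq_implies_less)
      show "finite {i. part mu i < part lam i}"
        by (rule finite_subset[of _ "{..length lam}"]) (auto simp: part_def split: if_splits)
    qed simp
    ultimately show "skewS lam mu V = (\<Sum>L\<in>lines U. skewS lam mu (quotW V L))"
      unfolding S using assms by (intro sum_lines_det_Hq[symmetric] a b) auto
  next
    assume card: "card {j. conj_part mu j < conj_part lam j} < fdim U"
    \<comment> \<open>The two conditions say that adding \<open>f j\<close> boxes to row j + 1 of
      \<open>mu\<close> for each j gives a horizontal strip inside \<open>lam\<close>. Its boxes lie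
      in distinct columns, so they are no more than the columns in which the two shapes
      differ.\<close>
    have "(\<Sum>j<N. f j) < fdim U"
      if le: "\<And>j. j < N \<Longrightarrow> b j + int (f j) \<le> a j"
        and gap: "\<And>j. Suc j < N \<Longrightarrow> b (Suc j) + int (f (Suc j)) < b j" for f
    proof -
      let ?I = "Sigma {..<N} (\<lambda>j. {..<f j})"
      \<comment> \<open>The column of box number s, counted from 0, that is added to row j +
        1.\<close>
      let ?h = "\<lambda>(j, s). part mu (Suc j) + Suc s"
      have less: "?h (j', s') < ?h (j, s)" if j: "j < j'" and s: "(j', s') \<in> ?I" for j j' s s'
      proof -
        obtain l where l: "j' = Suc l" "j \<le> l" using j by (cases j') auto
        have "part mu (Suc j') + f j' \<le> part mu j'" using gap[of l] s l by (simp add: b_def)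
        moreover have "part mu j' \<le> part mu (Suc j)" using mu_anti[of j l] l by simp
        ultimately show ?thesis using s by auto
      qed
      have "(\<Sum>j<N. f j) = card ?I" by simp
      also have "\<dots> \<le> card {j. conj_part mu j < conj_part lam j}"
      proof (rule card_inj_on_le[OF _ _ finite_conj_part_less])
        show "inj_on ?h ?I"
        proof (rule inj_onI)
          fix x y assume xy: "x \<in> ?I" "y \<in> ?I" "?h x = ?h y"
          obtain j s j' s' where eq: "x = (j, s)" "y = (j', s')" by (cases x, cases y)
          have "\<not> j < j'" "\<not> j' < j" using less[of j j' s' s] less[of j' j s s'] xy unfolding eq by auto
          thus "x = y" using xy unfolding eq by simp
        qed
        show "?h ` ?I \<subseteq> {j. conj_part mu j < conj_part lam j}"
        proof (clarsimp)
          fix j s assume "j < N" "s < f j"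
          thus "conj_part mu (Suc (part mu (Suc j) + s)) < conj_part lam (Suc (part mu (Suc j) + s))"
            using le[of j] by (intro conj_part_less[where i = j, OF sub]) (auto simp: a_def b_def)
        qed
      qed
      finally show ?thesis using card by simp
    qed
    thus "skewT lam mu V = (\<Sum>L\<in>lines U. skewT lam mu (quotW V L))"
      unfolding T using assms by (intro sum_lines_det_Eq[symmetric] a b ba) auto
  qed
qed

end
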